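(* Let $d\ge 1$, let $\mathsf{g}=\mathcal{N}(0,I_d)$, and let $X\sim\mu$ be a random vector in $\mathbb{R}^d$ with $\mathbb{E}[X]=0$ and $\mathbb{E}\|X\|^2<\infty$. Define $$\tau_1:=\mathbb{E}\big[\|X\|\mathbf 1_{\{\|X\|>1\}}\big],\qquad \tau_2:=\Big(\mathbb{E}\big[\|X\|^2\mathbf 1_{\{\|X\|>1\}}\big]\Big)^{1/2},$$ $$\widetilde X:=X\mathbf 1_{\{\|X\|\leq 1\}}-\mathbb{E}[X\mathbf 1_{\{\|X\|\leq 1\}}],\qquad \widetilde\Sigma:=\mathrm{Cov}(\widetilde X),$$ and let $c_4=(e^4-5)/16$. Then $$W_1(\mu*\mathsf{g},\mathsf{g})\le\big(\tau_1+\min(1,\tau_1)\big)+\sqrt{2\log\left(1+c_4\|\widetilde\Sigma\|_F^2\right)}$$ and $$W_2(\mu*\mathsf{g},\mathsf{g})\le\big(\tau_2+\min(1,\tau_2)\big)+\sqrt{2\log\left(1+c_4\|\widetilde\Sigma\|_F^2\right)}.$$ In particular, $$W_1(\mu*\mathsf{g},\mathsf{g})\leq 2\tau_1+\sqrt{2\log\left(1+c_4\|\widetilde\Sigma\|_F^2\right)},\qquad W_2(\mu*\mathsf{g},\mathsf{g})\leq 2\tau_2+\sqrt{2\log\left(1+c_4\|\widetilde\Sigma\|_F^2\right)}.$$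
   Context: $\|\cdot\|$ is the Euclidean norm on $\mathbb{R}^d$, $\|\cdot\|_F$ the Frobenius norm of matrices, $*$ denotes convolution of measures, and $W_p(\mu,\nu)=\left(\inf_{\tau\in\Pi(\mu,\nu)}\int\|z_1-z_2\|^p\,d\tau(z_1,z_2)\right)^{1/p}$ is the Wasserstein-$p$ distance, with $\Pi(\mu,\nu)$ the set of couplings of $\mu$ and $\nu$. *)

theory Defs
  imports "HOL-Probability.Probability"
begin

definition std_gaussian :: "(real ^ 'n) measure" where
  "std_gaussian = density lborel
     (\<lambda>x. ennreal ((2 * pi) powr (- real CARD('n) / 2) * exp (- (norm x)\<^sup>2 / 2)))"

definition couplings :: "'a measure \<Rightarrow> 'b measure \<Rightarrow> ('a \<times> 'b) measure set" where
  "couplings \<mu> \<nu> = {\<pi>. sets \<pi> = sets (\<mu> \<Otimes>\<^sub>M \<nu>) \<and> distr \<pi> \<mu> fst = \<mu> \<and> distr \<pi> \<nu> snd = \<nu>}"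

definition transport_cost ::
  "real \<Rightarrow> 'a::euclidean_space measure \<Rightarrow> 'a measure \<Rightarrow> ennreal" where
  "transport_cost p \<mu> \<nu> =
     (INF \<pi>\<in>couplings \<mu> \<nu>. \<integral>\<^sup>+ z. ennreal (norm (fst z - snd z) powr p) \<partial>\<pi>)"

(* Extended-valued: an upper bound by a real number includes finiteness of the distance.
   The case distinction extends the p-th root to infinity. *)
definition wasserstein ::
  "real \<Rightarrow> 'a::euclidean_space measure \<Rightarrow> 'a measure \<Rightarrow> ennreal" where
  "wasserstein p \<mu> \<nu> =
     (if transport_cost p \<mu> \<nu> = \<infinity> then \<infinity>
      else ennreal (enn2real (transport_cost p \<mu> \<nu>) powr (1 / p)))"

definition covariance_matrix :: "'s measure \<Rightarrow> ('s \<Rightarrow> real ^ 'n) \<Rightarrow> real ^ 'n ^ 'n" where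
  "covariance_matrix M Y =
     (\<chi> i j. \<integral>\<omega>. (Y \<omega> $ i - (\<integral>\<omega>'. Y \<omega>' $ i \<partial>M)) * (Y \<omega> $ j - (\<integral>\<omega>'. Y \<omega>' $ j \<partial>M)) \<partial>M)"

definition frobenius_norm :: "real ^ 'n ^ 'm \<Rightarrow> real" where
  "frobenius_norm A = sqrt (\<Sum>i\<in>UNIV. \<Sum>j\<in>UNIV. (A $ i $ j)\<^sup>2)"

lemma frobenius_norm_eq_norm: "frobenius_norm A = norm A"
  by (simp add: frobenius_norm_def norm_vec_def L2_set_def sum_nonneg)

definition tail_moment1 :: "'s measure \<Rightarrow> ('s \<Rightarrow> real ^ 'n) \<Rightarrow> real" where
  "tail_moment1 M X = (\<integral>\<omega>. norm (X \<omega>) * indicator {\<omega>. norm (X \<omega>) > 1} \<omega> \<partial>M)"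

definition tail_moment2 :: "'s measure \<Rightarrow> ('s \<Rightarrow> real ^ 'n) \<Rightarrow> real" where
  "tail_moment2 M X = sqrt (\<integral>\<omega>. (norm (X \<omega>))\<^sup>2 * indicator {\<omega>. norm (X \<omega>) > 1} \<omega> \<partial>M)"

definition truncate1 :: "('s \<Rightarrow> real ^ 'n) \<Rightarrow> 's \<Rightarrow> real ^ 'n" where
  "truncate1 X \<omega> = indicator {\<omega>. norm (X \<omega>) \<le> 1} \<omega> *\<^sub>R X \<omega>"

definition centered_truncation :: "'s measure \<Rightarrow> ('s \<Rightarrow> real ^ 'n) \<Rightarrow> 's \<Rightarrow> real ^ 'n" where
  "centered_truncation M X \<omega> = truncate1 X \<omega> - (\<integral>\<omega>'. truncate1 X \<omega>' \<partial>M)"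

definition c4 :: real where
  "c4 = (exp 4 - 5) / 16"

end

theory Submission
  imports Defs "HOL-Real_Asymp.Real_Asymp"
begin

text \<open>Truncating \<open>X\<close> at norm \<open>1\<close> and recentring gives \<open>Y\<close> with \<open>\<parallel>Y\<parallel> \<le> 2\<close>; coupling \<open>X + Z\<close> to
  \<open>Y + Z\<close> with the same Gaussian \<open>Z\<close> costs the tail terms. The law of \<open>Y + Z\<close> has density
  \<open>f x = E exp (x \<bullet> Y - \<parallel>Y\<parallel>\<^sup>2 / 2)\<close> with respect to the Gaussian measure, and Talagrand's inequality
  bounds its squared transport cost to the Gaussian by \<open>2 E f ln f \<le> 2 ln (E f\<^sup>2)\<close>. Here
  \<open>E f\<^sup>2 = E exp (Y \<bullet> Y')\<close> for an independent copy \<open>Y'\<close>; since \<open>\<bar>Y \<bullet> Y'\<bar> \<le> 4\<close>, the bound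
  \<open>exp t \<le> 1 + t + c4 t\<^sup>2\<close> on \<open>[-4, 4]\<close> leaves \<open>1 + c4\<close> times the squared Frobenius norm of the
  covariance.

  Talagrand's inequality is obtained with the Knothe map: the coordinates are transported one at a
  time by the monotone rearrangement of their conditional law, which is again a Gaussian smoothing of
  a bounded random variable, and the entropies add up by the chain rule. As the transport is a map
  \<open>S\<close>, no gluing of couplings is needed: \<open>S (Y + Z)\<close> lives on the same probability space as
  \<open>X + Z\<close>.\<close>

section \<open>Transport on the real line\<close>

text \<open>Boundedness of \<open>Y\<close> does more than confine the exponent to [-4, 4]. A
  Gaussian shifted by at most \<open>K\<close> has its distribution function squeezed between two
  shifted copies of the standard one, so the monotone map moves no point by more than
  \<open>K\<close>. Hence every transport cost is integrable, the boundary terms of the integration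
  by parts vanish, and one exponential dominating function serves all the entropies. The bound also
  survives conditioning: fixing some coordinates of \<open>Y + Z\<close> only reweights the
  underlying probability space, so each step of the induction over coordinates is the same
  one-dimensional statement with the same \<open>K\<close>. The price of the Knothe map is joint
  measurability: each step is defined through an inverse function that depends on the previous
  coordinates. The term min(1, tau_1) is the cost of recentring. The truncated vector has a mean of
  norm at most 1, and because E X = 0 this mean is minus the mean of the discarded tail, hence of
  norm at most tau_1.\<close>

locale pos_cont_density =
  fixes p :: "real \<Rightarrow> real"
  assumes cont: "continuous_on UNIV p" and pos: "0 < p t"
    and prob: "prob_space (density lborel p)"
begin

sublocale real_distribution "density lborel p"
  using prob by (simp add: real_distribution_def real_distribution_axioms_def)

abbreviation "P \<equiv> cdf (density lborel p)"

lemma measurable_p [measurable]: "p \<in> borel_measurable borel"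
  using cont by (rule borel_measurable_continuous_onI)

lemma cdf_diff_integral:
  assumes "x \<le> y"
  shows "P y - P x = integral {x..y} p"
proof -
  have si: "set_integrable lborel {x..y} p"
    by (rule borel_integrable_atLeastAtMost') (use cont continuous_on_subset in blast)
  have "P y - P x = measure (density lborel p) {x<..y}"
    using assms cdf_diff_eq[of x y] by (cases "x = y") auto
  also have "\<dots> = measure (density lborel p) {x..y}"
  proof -
    have "emeasure (density lborel p) {x<..y} = emeasure (density lborel p) {x..y}"
    proof (rule emeasure_eq_AE)
      have "AE t in lborel. t \<noteq> x" by (rule AE_lborel_singleton)
      then show "AE t in density lborel p. (t \<in> {x<..y}) = (t \<in> {x..y})"
        by (subst AE_density) (auto elim!: eventually_mono)
    qed auto
    then show ?thesis by (simp add: measure_def)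
  qed
  also have "\<dots> = integral\<^sup>L lborel (\<lambda>t. indicator {x..y} t * p t)"
    by (subst integral_eq_nn_integral)
      (auto simp: measure_def emeasure_density less_imp_le[OF pos] mult.commute ennreal_indicator intro!: arg_cong[where f=enn2real] nn_integral_cong split: split_indicator)
  also have "\<dots> = integral {x..y} p"
    using set_borel_integral_eq_integral(2)[OF si] by (simp add: set_lebesgue_integral_def)
  finally show ?thesis .
qed

lemma DERIV_cdf: "(P has_real_derivative p t) (at t)"
proof -
  have "((\<lambda>u. integral {t-1..u} p) has_real_derivative p t) (at t within {t-1..t+1})"
    by (rule integral_has_real_derivative[OF continuous_on_subset[OF cont]]) auto
  then have "((\<lambda>u. P (t-1) + integral {t-1..u} p) has_real_derivative p t) (at t within {t-1..t+1})"
    by (auto intro!: derivative_eq_intros)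
  then have "(P has_real_derivative p t) (at t within {t-1..t+1})"
  proof (rule has_field_derivative_transform_within[where d = 1])
    show "P (t-1) + integral {t-1..u} p = P u" if "u \<in> {t-1..t+1}" for u
      using cdf_diff_integral[of "t-1" u] that by auto
  qed auto
  moreover have "at t within {t-1..t+1} = at t"
    by (rule at_within_interior) simp
  ultimately show ?thesis by simp
qed

lemma isCont_P: "isCont P t"
  using DERIV_cdf by (rule DERIV_isCont)

lemma cdf_less: "x < y \<Longrightarrow> P x < P y"
  by (rule DERIV_pos_imp_increasing) (use DERIV_cdf pos in blast)+

lemma cdf_less_iff: "P x < P y \<longleftrightarrow> x < y"
  using cdf_less[of x y] cdf_less[of y x] by (cases x y rule: linorder_cases) auto

lemma cdf_le_iff: "P x \<le> P y \<longleftrightarrow> x \<le> y"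
  using cdf_less_iff[of y x] by linarith

lemma inj_cdf: "inj P"
  by (rule injI) (metis cdf_le_iff order_antisym order_refl)

lemma cdf_pos: "0 < P t"
  using cdf_nonneg[of "t-1"] cdf_less[of "t-1" t] by simp

lemma cdf_less_1: "P t < 1"
  using cdf_bounded_prob[of "t+1"] cdf_less[of t "t+1"] by simp

lemma cdf_surj:
  assumes "0 < u" "u < 1"
  shows "\<exists>t. P t = u"
proof -
  have "eventually (\<lambda>t. P t < u) at_bot" "eventually (\<lambda>t. u < P t) at_top"
    using order_tendstoD(2)[OF cdf_lim_at_bot assms(1)] order_tendstoD(1)[OF cdf_lim_at_top_prob assms(2)]
    by auto
  then obtain a b where ab: "P a < u" "u < P b"
    by (auto simp: eventually_at_bot_linorder eventually_at_top_linorder)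
  then have "a \<le> b" using cdf_less_iff[of a b] by simp
  then show ?thesis
    using IVT[of P a u b] ab isCont_P by (auto simp: less_imp_le)
qed

end

section \<open>The standard normal density: tilts, shifts and dominating functions\<close>

lemma normal_pos_cont_density: "pos_cont_density std_normal_density"
proof (rule pos_cont_density.intro)
  show "continuous_on UNIV std_normal_density"
    unfolding normal_density_def by (intro continuous_intros) auto
qed (rule normal_density_pos prob_space_normal_density; simp)+

interpretation normal: pos_cont_density std_normal_density
  by (rule normal_pos_cont_density)

abbreviation "normal_cdf \<equiv> cdf std_normal_distribution"

text \<open>Completing the square: an exponential tilt of the Gaussian is a multiple of a shifted
  Gaussian, hence integrable.\<close>

lemma std_normal_density_mult_exp:
  "std_normal_density t * exp (a * t) = exp (a\<^sup>2 / 2) * normal_density a 1 t"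
  by (simp add: normal_density_def power2_diff exp_add[symmetric] field_simps)

text \<open>The one-dimensional Cameron-Martin formula: the exponential is the likelihood ratio of
  N(y, 1) to N(0, 1). It is the source of the integrand defining \<open>f\<close>.\<close>

lemma std_normal_density_shift:
  "std_normal_density t * exp (t * y - y\<^sup>2 / 2) = std_normal_density (t - y)"
  by (simp add: normal_density_def power2_diff exp_add[symmetric] field_simps)

text \<open>The exponential of \<open>a * \<bar>t\<bar>\<close> is at most the sum of the two
  one-sided tilts. With \<open>a = 2 * K\<close> this is the dominating function for both
  \<open>H'\<close> and the entropy.\<close>

lemma integrable_normal_exp_abs:
  "integrable lborel (\<lambda>t. std_normal_density t * exp (a * \<bar>t\<bar>))"
proof (rule Bochner_Integration.integrable_bound)
  have "integrable lborel (\<lambda>t. std_normal_density t * exp (b * t))" for b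
    unfolding std_normal_density_mult_exp by simp
  from this[of a] this[of "- a"]
  show "integrable lborel (\<lambda>t. std_normal_density t * exp (a * t) + std_normal_density t * exp (- a * t))"
    by (rule Bochner_Integration.integrable_add)
  show "AE t in lborel. norm (std_normal_density t * exp (a * \<bar>t\<bar>))
      \<le> norm (std_normal_density t * exp (a * t) + std_normal_density t * exp (- a * t))"
  proof (rule AE_I2)
    fix t :: real
    have "exp (a * \<bar>t\<bar>) \<le> exp (a * t) + exp (- a * t)"
      by (cases "0 \<le> t") auto
    then show "norm (std_normal_density t * exp (a * \<bar>t\<bar>))
      \<le> norm (std_normal_density t * exp (a * t) + std_normal_density t * exp (- a * t))"
      by (simp add: distrib_left[symmetric] mult_left_mono abs_mult)
  qed
qed simp

lemma DERIV_std_normal_density: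
  "(std_normal_density has_real_derivative (- t * std_normal_density t)) (at t)"
  unfolding normal_density_def by (auto intro!: derivative_eq_intros simp: real_div_sqrt field_simps)

text \<open>The upper half uses ln u < u, the lower half ln u >= 1 - 1/u. It reduces integrability
  of an entropy to that of the squared density.\<close>

lemma abs_mult_ln_le:
  assumes "0 < (u::real)" shows "\<bar>u * ln u\<bar> \<le> u\<^sup>2 + 1"
proof -
  have 1: "u * ln u \<le> u\<^sup>2"
    unfolding power2_eq_square using assms ln_less_self[of u] by (intro mult_left_mono) linarith+
  have "u * (1 - 1 / u) \<le> u * ln u"
    using assms ln_le_minus_one[of "1/u"] by (intro mult_left_mono) (auto simp: ln_div)
  then have "u - 1 \<le> u * ln u" using assms by (simp add: right_diff_distrib)
  with 1 show ?thesis using assms zero_le_power2[of u] by linarith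
qed

section \<open>Gaussian smoothing of one bounded random variable\<close>

locale bounded_rv = prob_space +
  fixes Y :: "'a \<Rightarrow> real" and K :: real
  assumes measurable_Y [measurable]: "Y \<in> borel_measurable M"
    and bounded_Y: "\<omega> \<in> space M \<Longrightarrow> \<bar>Y \<omega>\<bar> \<le> K"
begin

text \<open>\<open>p\<close> is the Lebesgue density of the law of \<open>Y + Z\<close> for an independent standard Gaussian \<open>Z\<close>,
  and \<open>f\<close> its density relative to the Gaussian measure.\<close>

definition f :: "real \<Rightarrow> real" where
  "f t = (\<integral>\<omega>. exp (t * Y \<omega> - (Y \<omega>)\<^sup>2 / 2) \<partial>M)"

definition p :: "real \<Rightarrow> real" where
  "p t = (\<integral>\<omega>. std_normal_density (t - Y \<omega>) \<partial>M)"

lemma K_nonneg: "0 \<le> K"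
  using not_empty bounded_Y by (meson abs_ge_zero all_not_in_conv order_trans)

lemma exponent_le:
  assumes "\<omega> \<in> space M" shows "t * Y \<omega> - (Y \<omega>)\<^sup>2 / 2 \<le> K * \<bar>t\<bar>"
proof -
  have "t * Y \<omega> \<le> \<bar>t\<bar> * \<bar>Y \<omega>\<bar>" by (metis abs_ge_self abs_mult)
  also have "\<dots> \<le> \<bar>t\<bar> * K" using bounded_Y[OF assms] by (rule mult_left_mono) simp
  finally have "t * Y \<omega> \<le> K * \<bar>t\<bar>" by (simp add: mult.commute)
  then show ?thesis using zero_le_power2[of "Y \<omega>"] by linarith
qed

lemma integrable_exponent: "integrable M (\<lambda>\<omega>. exp (t * Y \<omega> - (Y \<omega>)\<^sup>2 / 2))"
  by (rule integrable_const_bound[where B = "exp (K * \<bar>t\<bar>)"]) (auto intro!: exponent_le)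

lemma p_eq: "p t = std_normal_density t * f t"
  unfolding p_def f_def std_normal_density_shift[symmetric] by simp

lemma f_le: "f t \<le> exp (K * \<bar>t\<bar>)"
proof -
  have "f t \<le> (\<integral>\<omega>. exp (K * \<bar>t\<bar>) \<partial>M)"
    unfolding f_def by (intro integral_mono_AE integrable_exponent) (auto intro!: AE_I2 exponent_le)
  then show ?thesis by (simp add: prob_space)
qed

lemma f_pos: "0 < f t"
proof -
  have "f t \<noteq> 0"
  proof
    assume "f t = 0"
    then have "AE \<omega> in M. exp (t * Y \<omega> - (Y \<omega>)\<^sup>2 / 2) = 0"
      unfolding f_def by (subst (asm) integral_nonneg_eq_0_iff_AE[OF integrable_exponent]) auto
    then show False by simp
  qed
  moreover have "0 \<le> f t" unfolding f_def by (intro Bochner_Integration.integral_nonneg) simp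
  ultimately show ?thesis by simp
qed

lemma p_pos: "0 < p t"
  unfolding p_eq using f_pos by (intro mult_pos_pos normal_density_pos) auto

lemma p_le: "p t \<le> std_normal_density t * exp (K * \<bar>t\<bar>)"
  unfolding p_eq using f_le by (intro mult_left_mono) auto

lemma isCont_std_normal_density: "isCont std_normal_density t"
  using DERIV_std_normal_density by (rule DERIV_isCont)

lemma std_normal_density_le: "std_normal_density t \<le> 1 / sqrt (2 * pi)"
  by (simp add: normal_density_def divide_right_mono)

lemma isCont_p: "isCont p t"
  unfolding isCont_def continuous_within p_def tendsto_at_iff_sequentially comp_def
proof (intro allI impI)
  fix X assume X: "\<forall>i. X i \<in> UNIV - {t}" "X \<longlonglongrightarrow> t"
  show "(\<lambda>i. \<integral>\<omega>. std_normal_density (X i - Y \<omega>) \<partial>M) \<longlonglongrightarrow> (\<integral>\<omega>. std_normal_density (t - Y \<omega>) \<partial>M)"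
  proof (rule integral_dominated_convergence[where w = "\<lambda>_. 1 / sqrt (2 * pi)"])
    show "AE \<omega> in M. (\<lambda>i. std_normal_density (X i - Y \<omega>)) \<longlonglongrightarrow> std_normal_density (t - Y \<omega>)"
      using X by (intro AE_I2 isCont_tendsto_compose[OF isCont_std_normal_density] tendsto_intros)
    show "AE \<omega> in M. norm (std_normal_density (X i - Y \<omega>)) \<le> 1 / sqrt (2 * pi)" for i
      using std_normal_density_le by simp
  qed auto
qed

lemma measurable_p [measurable]: "p \<in> borel_measurable borel"
  by (intro borel_measurable_continuous_onI continuous_at_imp_continuous_on ballI isCont_p)

lemma measurable_f [measurable]: "f \<in> borel_measurable borel"
proof -
  have "f = (\<lambda>t. p t / std_normal_density t)"
    using normal.pos by (auto simp: p_eq fun_eq_iff less_imp_neq[symmetric])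
  then show ?thesis by simp
qed

text \<open>Fubini and a translation of the Lebesgue integral exhibit the law with density
  \<open>p\<close> as a mixture of Gaussians shifted by \<open>Y \<omega>\<close>, that is, as the
  law of \<open>Y + Z\<close>.\<close>

lemma emeasure_p:
  assumes [measurable]: "A \<in> sets borel"
  shows "emeasure (density lborel p) A = (\<integral>\<^sup>+\<omega>. emeasure std_normal_distribution ((\<lambda>v. v + Y \<omega>) -` A) \<partial>M)"
proof -
  interpret pair_sigma_finite lborel M
    by (intro pair_sigma_finite.intro sigma_finite_lborel sigma_finite_measure_axioms)
  have p: "ennreal (p t) = (\<integral>\<^sup>+\<omega>. std_normal_density (t - Y \<omega>) \<partial>M)" for t
    unfolding p_def using std_normal_density_le
    by (intro nn_integral_eq_integral[symmetric] integrable_const_bound[where B = "1 / sqrt (2 * pi)"]) auto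
  have "emeasure (density lborel p) A = (\<integral>\<^sup>+t. \<integral>\<^sup>+\<omega>. std_normal_density (t - Y \<omega>) * indicator A t \<partial>M \<partial>lborel)"
    by (simp add: emeasure_density p nn_integral_multc[symmetric] ennreal_mult'' ennreal_indicator)
  also have "\<dots> = (\<integral>\<^sup>+\<omega>. \<integral>\<^sup>+t. std_normal_density (t - Y \<omega>) * indicator A t \<partial>lborel \<partial>M)"
    by (rule Fubini'[symmetric]) measurable
  also have "\<dots> = (\<integral>\<^sup>+\<omega>. emeasure std_normal_distribution ((\<lambda>v. v + Y \<omega>) -` A) \<partial>M)"
  proof (rule nn_integral_cong)
    fix \<omega>
    have [measurable]: "(\<lambda>v. v + Y \<omega>) -` A \<in> sets borel"
      using measurable_sets[of "\<lambda>v. v + Y \<omega>" borel borel A] by simp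
    have "(\<integral>\<^sup>+t. std_normal_density (t - Y \<omega>) * indicator A t \<partial>lborel)
      = (\<integral>\<^sup>+v. std_normal_density v * indicator ((\<lambda>v. v + Y \<omega>) -` A) v \<partial>lborel)"
      by (subst nn_integral_real_affine[where c = 1 and t = "Y \<omega>"])
        (auto intro!: nn_integral_cong simp: add.commute split: split_indicator)
    then show "(\<integral>\<^sup>+t. std_normal_density (t - Y \<omega>) * indicator A t \<partial>lborel)
      = emeasure std_normal_distribution ((\<lambda>v. v + Y \<omega>) -` A)"
      by (simp add: emeasure_density ennreal_mult'' ennreal_indicator)
  qed
  finally show ?thesis .
qed

sublocale law: pos_cont_density p
proof (rule pos_cont_density.intro)
  show "continuous_on UNIV p" by (intro continuous_at_imp_continuous_on ballI isCont_p)
  show "prob_space (density lborel p)"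
  proof
    have "emeasure std_normal_distribution UNIV = 1"
      using normal.emeasure_space_1 by simp
    then show "emeasure (density lborel p) (space (density lborel p)) = 1"
      using emeasure_p[of UNIV] emeasure_space_1 by simp
  qed
qed (rule p_pos)

text \<open>The mixture formula makes \<open>law.P t\<close> the average of
  \<open>normal_cdf (t - Y \<omega>)\<close>, and each of these values lies between the two bounds
  because \<open>\<bar>Y \<omega>\<bar> \<le> K\<close>.\<close>

lemma cdf_bounds: "normal_cdf (t - K) \<le> law.P t" "law.P t \<le> normal_cdf (t + K)"
proof -
  have c: "emeasure std_normal_distribution {..u} = ennreal (normal_cdf u)" for u
    by (simp add: cdf_def normal.emeasure_eq_measure)
  have e: "ennreal (law.P t) = (\<integral>\<^sup>+\<omega>. ennreal (normal_cdf (t - Y \<omega>)) \<partial>M)"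
  proof -
    have "ennreal (law.P t) = emeasure (density lborel p) {..t}"
      unfolding cdf_def by (rule law.emeasure_eq_measure[symmetric])
    also have "\<dots> = (\<integral>\<^sup>+\<omega>. ennreal (normal_cdf (t - Y \<omega>)) \<partial>M)"
    proof -
      have "(\<lambda>v. v + Y \<omega>) -` {..t} = {..t - Y \<omega>}" for \<omega> by auto
      then show ?thesis by (simp add: emeasure_p c)
    qed
    finally show ?thesis .
  qed
  have "(\<integral>\<^sup>+\<omega>. ennreal (normal_cdf (t - K)) \<partial>M) \<le> ennreal (law.P t)"
    unfolding e using bounded_Y
    by (intro nn_integral_mono ennreal_leI normal.cdf_nondecreasing) (auto simp: abs_le_iff)
  then show "normal_cdf (t - K) \<le> law.P t"
    by (simp add: emeasure_space_1 law.cdf_nonneg)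
  have "ennreal (law.P t) \<le> (\<integral>\<^sup>+\<omega>. ennreal (normal_cdf (t + K)) \<partial>M)"
    unfolding e using bounded_Y
    by (intro nn_integral_mono ennreal_leI normal.cdf_nondecreasing) (force simp: abs_le_iff)
  then show "law.P t \<le> normal_cdf (t + K)"
    by (simp add: emeasure_space_1 normal.cdf_nonneg)
qed

text \<open>The monotone rearrangement of the law of \<open>Y + Z\<close> onto the Gaussian. The
  inverse is genuine here, since \<open>law.P t\<close> lies strictly between 0 and 1 and
  \<open>normal_cdf\<close> is injective with all these values in its range.\<close>

definition s :: "real \<Rightarrow> real" where
  "s t = inv normal_cdf (law.P t)"

lemma normal_cdf_inv: "0 < u \<Longrightarrow> u < 1 \<Longrightarrow> normal_cdf (inv normal_cdf u) = u"
  using normal.cdf_surj by (metis f_inv_into_f rangeI)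

lemma normal_cdf_s: "normal_cdf (s t) = law.P t"
  unfolding s_def by (intro normal_cdf_inv law.cdf_pos law.cdf_less_1)

lemma s_le_iff: "s t \<le> a \<longleftrightarrow> law.P t \<le> normal_cdf a"
  using normal.cdf_le_iff[of "s t" a] by (simp add: normal_cdf_s)

text \<open>Apply the strictly increasing inverse of \<open>normal_cdf\<close> to
  \<open>cdf_bounds\<close>. This is what makes the later integrability and limit arguments
  work.\<close>

lemma s_bounds: "\<bar>s t - t\<bar> \<le> K"
proof -
  have "normal_cdf (t - K) \<le> normal_cdf (s t)" "normal_cdf (s t) \<le> normal_cdf (t + K)"
    unfolding normal_cdf_s by (rule cdf_bounds)+
  then show ?thesis by (simp add: normal.cdf_le_iff abs_le_iff)
qed

text \<open>The Monge-Ampere equation, from the chain rule and the derivative of the inverse of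
  \<open>normal_cdf\<close>.\<close>

lemma DERIV_s: "(s has_real_derivative (p t / std_normal_density (s t))) (at t)"
proof -
  have c: "isCont (inv normal_cdf) (normal_cdf (s t))"
    by (rule isCont_inverse_function2[where a = "s t - 1" and b = "s t + 1"])
      (auto simp: inv_f_f[OF normal.inj_cdf] normal.isCont_P)
  have "(inv normal_cdf has_real_derivative inverse (std_normal_density (s t))) (at (law.P t))"
  proof (rule DERIV_inverse_function[where a = 0 and b = 1])
    show "(normal_cdf has_real_derivative std_normal_density (s t)) (at (inv normal_cdf (law.P t)))"
      using normal.DERIV_cdf[of "s t"] by (simp add: s_def)
    show "std_normal_density (s t) \<noteq> 0" using normal.pos[of "s t"] by simp
    show "isCont (inv normal_cdf) (law.P t)" using c by (simp add: normal_cdf_s)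
  qed (auto simp: law.cdf_pos law.cdf_less_1 normal_cdf_inv)
  from DERIV_chain2[OF this law.DERIV_cdf] show ?thesis
    unfolding s_def[abs_def] by (simp add: field_simps)
qed

lemma isCont_s: "isCont s t"
  using DERIV_s by (rule DERIV_isCont)

lemma measurable_s [measurable]: "s \<in> borel_measurable borel"
  by (intro borel_measurable_continuous_onI continuous_at_imp_continuous_on ballI isCont_s)

text \<open>Distribution functions agree: the preimage of a half-line \<open>{..a}\<close> under
  \<open>s\<close> is the half-line ending at the point \<open>c\<close> where
  \<open>law.P c = normal_cdf a\<close>.\<close>

lemma distr_s: "distr (density lborel p) borel s = std_normal_distribution"
proof (rule cdf_unique)
  show "real_distribution (distr (density lborel p) borel s)"
    by (rule law.real_distribution_distr) simp
  show "real_distribution std_normal_distribution" by unfold_locales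
  show "cdf (distr (density lborel p) borel s) = normal_cdf"
  proof
    fix a
    obtain c where c: "law.P c = normal_cdf a"
      using law.cdf_surj[OF normal.cdf_pos normal.cdf_less_1] by blast
    have "s -` {..a} = {..c}"
      by (auto simp: s_le_iff c[symmetric] law.cdf_le_iff)
    then have "cdf (distr (density lborel p) borel s) a = measure (density lborel p) {..c}"
      by (simp add: cdf_def measure_distr)
    then show "cdf (distr (density lborel p) borel s) a = normal_cdf a"
      using c by (simp add: cdf_def)
  qed
qed

text \<open>That \<open>H'\<close> integrates to zero is Gaussian integration by parts for the inverse \<open>T\<close> of \<open>s\<close>,
  \<open>E (Z (T Z - Z)) = E (T' Z - 1)\<close>, after the change of variables \<open>Z = s t\<close>.\<close>

definition H :: "real \<Rightarrow> real" where
  "H t = std_normal_density (s t) * (t - s t)"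

definition H' :: "real \<Rightarrow> real" where
  "H' t = std_normal_density (s t) - p t * (s t * (t - s t) + 1)"

text \<open>The derivative of the Gaussian factor contributes
  \<open>std_normal_density (s t)\<close>, which cancels the denominator of the derivative of
  \<open>s\<close>.\<close>

lemma DERIV_H: "(H has_real_derivative H' t) (at t)"
proof -
  have "((\<lambda>t. std_normal_density (s t)) has_real_derivative
      - s t * std_normal_density (s t) * (p t / std_normal_density (s t))) (at t)"
    by (rule DERIV_chain2[OF DERIV_std_normal_density DERIV_s])
  then have "((\<lambda>t. std_normal_density (s t)) has_real_derivative - s t * p t) (at t)"
    using normal.pos[of "s t"] by simp
  from DERIV_mult[OF this DERIV_diff[OF DERIV_ident DERIV_s]]
  have "(H has_real_derivative - s t * p t * (t - s t)
      + (1 - p t / std_normal_density (s t)) * std_normal_density (s t)) (at t)"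
    unfolding H_def[abs_def] .
  also have "- s t * p t * (t - s t) + (1 - p t / std_normal_density (s t)) * std_normal_density (s t) = H' t"
    using normal.pos[of "s t"] unfolding H'_def by (simp add: field_simps)
  finally show ?thesis .
qed

lemma isCont_H': "isCont H' t"
  unfolding H'_def[abs_def]
  by (intro continuous_intros isCont_o2[OF isCont_s isCont_std_normal_density] isCont_s isCont_p)

lemma measurable_H' [measurable]: "H' \<in> borel_measurable borel"
  by (intro borel_measurable_continuous_onI continuous_at_imp_continuous_on ballI isCont_H')

text \<open>With displacement \<open>s t - t\<close> of size at most \<open>K\<close>, the
  difference of squares t^2 - s^2 = -2t(s - t) - (s - t)^2 is at most 2K|t|.\<close>

lemma std_normal_density_s_le: "std_normal_density (s t) \<le> std_normal_density t * exp (K * \<bar>t\<bar>)"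
proof -
  have "- (t * (s t - t)) \<le> \<bar>t\<bar> * \<bar>s t - t\<bar>"
    by (metis abs_ge_minus_self abs_mult)
  also have "\<dots> \<le> \<bar>t\<bar> * K" by (rule mult_left_mono[OF s_bounds]) simp
  finally have "t\<^sup>2 - (s t)\<^sup>2 \<le> 2 * (K * \<bar>t\<bar>)"
    using zero_le_power2[of "s t - t"] by (simp add: power2_eq_square algebra_simps)
  then have "exp (- (s t)\<^sup>2 / 2) \<le> exp (- t\<^sup>2 / 2) * exp (K * \<bar>t\<bar>)"
    by (simp add: exp_add[symmetric] field_simps)
  then show ?thesis by (simp add: std_normal_density_def divide_right_mono)
qed

text \<open>Write \<open>e\<close> for the exponential of K|t|. The polynomial factor is at most (1
  + K^2) e because 1 + K|t| <= e and 1 <= e, and \<open>p t\<close> supplies a second factor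
  \<open>e\<close>. The remaining summand \<open>std_normal_density (s t)\<close> raises 1 + K^2 to
  K^2 + 2.\<close>

lemma H'_bound: "\<bar>H' t\<bar> \<le> (K\<^sup>2 + 2) * (std_normal_density t * exp (2 * K * \<bar>t\<bar>))"
proof -
  have K: "0 \<le> K" by (rule K_nonneg)
  define e where "e = exp (K * \<bar>t\<bar>)"
  define g where "g = std_normal_density t"
  have e: "1 + K * \<bar>t\<bar> \<le> e" unfolding e_def by (rule exp_ge_add_one_self)
  then have e1: "1 \<le> e" using K by (smt (verit) abs_ge_zero mult_nonneg_nonneg)
  have g: "0 \<le> g" unfolding g_def by simp
  have "\<bar>s t * (t - s t)\<bar> \<le> (\<bar>t\<bar> + K) * K"
    unfolding abs_mult using s_bounds[of t] K by (intro mult_mono) auto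
  then have "\<bar>s t * (t - s t) + 1\<bar> \<le> K * \<bar>t\<bar> + 1 + K\<^sup>2"
    by (simp add: power2_eq_square algebra_simps)
  also have "\<dots> \<le> e + K\<^sup>2 * e"
    using e mult_left_mono[OF e1 zero_le_power2[of K]] by simp
  finally have 1: "\<bar>s t * (t - s t) + 1\<bar> \<le> (1 + K\<^sup>2) * e" by (simp add: algebra_simps)
  have "\<bar>p t * (s t * (t - s t) + 1)\<bar> \<le> (g * e) * ((1 + K\<^sup>2) * e)"
    unfolding abs_mult[of "p t"] using p_le[of t] law.pos[of t] 1 g e1
    by (intro mult_mono) (auto simp: g_def e_def)
  moreover have "\<bar>std_normal_density (s t)\<bar> \<le> g * e * e"
    using std_normal_density_s_le[of t] mult_left_mono[OF e1, of "g * e"] g e1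
    by (simp add: g_def e_def)
  ultimately have "\<bar>H' t\<bar> \<le> g * e * e + (g * e) * ((1 + K\<^sup>2) * e)"
    unfolding H'_def by (smt (verit))
  also have "\<dots> = (K\<^sup>2 + 2) * (g * (e * e))" by (simp add: algebra_simps)
  also have "e * e = exp (2 * K * \<bar>t\<bar>)" by (simp add: e_def exp_add[symmetric])
  finally show ?thesis by (simp add: g_def)
qed

lemma integrable_H': "integrable lborel H'"
  by (rule Bochner_Integration.integrable_bound[OF integrable_mult_right[OF integrable_normal_exp_abs[of "2 * K"], of "K\<^sup>2 + 2"]])
    (use H'_bound in \<open>auto simp: abs_mult\<close>)

lemma std_normal_density_tendsto_0:
  "(std_normal_density \<longlongrightarrow> 0) at_top" "(std_normal_density \<longlongrightarrow> 0) at_bot"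
  unfolding normal_density_def by real_asymp+

text \<open>The primitive \<open>H\<close> vanishes at both ends: \<open>s t\<close> stays within
  \<open>K\<close> of \<open>t\<close>, so the Gaussian factor tends to 0 while the factor
  \<open>t - s t\<close> stays bounded.\<close>

lemma integral_H': "integral\<^sup>L lborel H' = 0"
proof -
  have top: "filterlim s at_top at_top"
  proof (rule filterlim_at_top_mono)
    show "filterlim (\<lambda>t. t - K) at_top at_top" by real_asymp
    show "eventually (\<lambda>t. t - K \<le> s t) at_top"
      using s_bounds by (intro always_eventually) (auto simp: abs_le_iff algebra_simps)
  qed
  have bot: "filterlim s at_bot at_bot"
  proof (rule filterlim_at_bot_mono)
    show "filterlim (\<lambda>t. t + K) at_bot at_bot" by real_asymp
    show "eventually (\<lambda>t. s t \<le> t + K) at_bot"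
      using s_bounds by (intro always_eventually) (auto simp: abs_le_iff algebra_simps)
  qed
  have lim: "(H \<longlongrightarrow> 0) F" if "((\<lambda>t. std_normal_density (s t)) \<longlongrightarrow> 0) F" for F
    unfolding H_def
  proof (rule Lim_null_comparison[where g = "\<lambda>t. std_normal_density (s t) * K"])
    show "eventually (\<lambda>t. norm (std_normal_density (s t) * (t - s t)) \<le> std_normal_density (s t) * K) F"
      using s_bounds by (intro always_eventually) (auto simp: abs_mult abs_minus_commute intro!: mult_left_mono)
    show "((\<lambda>t. std_normal_density (s t) * K) \<longlongrightarrow> 0) F"
      using tendsto_mult_right[OF that, of K] by simp
  qed
  have "(LBINT t=-\<infinity>..\<infinity>. H' t) = 0 - 0"
  proof (rule interval_integral_FTC_integrable)
    show "(H has_vector_derivative H' t) (at t)" for t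
      using DERIV_H by (simp add: has_real_derivative_iff_has_vector_derivative)
    show "isCont H' t" for t by (rule isCont_H')
    show "set_integrable lborel (einterval (- \<infinity>) \<infinity>) H'"
      using integrable_H' by (simp add: set_integrable_def)
    show "((H \<circ> real_of_ereal) \<longlongrightarrow> 0) (at_right (- \<infinity>))"
      using lim[OF filterlim_compose[OF std_normal_density_tendsto_0(2) bot]]
      by (simp add: ereal_tendsto_simps)
    show "((H \<circ> real_of_ereal) \<longlongrightarrow> 0) (at_left \<infinity>)"
      using lim[OF filterlim_compose[OF std_normal_density_tendsto_0(1) top]]
      by (simp add: ereal_tendsto_simps)
  qed simp
  then show ?thesis
    by (simp add: interval_lebesgue_integral_def set_lebesgue_integral_def)
qed

text \<open>From the Monge-Ampere equation \<open>p t = s' t \<cdot> std_normal_density (s t)\<close> and \<open>ln s' \<ge> 1 - 1 / s'\<close>.\<close>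

lemma entropy_pointwise:
  "p t * (s t - t)\<^sup>2 / 2 - H' t \<le> p t * ln (f t)"
proof -
  define r where "r = p t / std_normal_density (s t)"
  have r: "0 < r" unfolding r_def using law.pos normal.pos by (intro divide_pos_pos)
  have n: "std_normal_density u = exp (- u\<^sup>2 / 2 - ln (sqrt (2 * pi)))" for u
    by (simp add: std_normal_density_def exp_diff)
  have "f t = r * (std_normal_density (s t) / std_normal_density t)"
    using normal.pos[of t] normal.pos[of "s t"] by (simp add: r_def p_eq)
  also have "std_normal_density (s t) / std_normal_density t = exp ((t\<^sup>2 - (s t)\<^sup>2) / 2)"
    unfolding n by (simp add: exp_diff[symmetric] field_simps)
  finally have "ln (f t) = ln r + (t\<^sup>2 - (s t)\<^sup>2) / 2"
    using r by (simp add: ln_mult)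
  moreover have "1 - 1 / r \<le> ln r"
    using ln_le_minus_one[of "1 / r"] r by (simp add: ln_div)
  ultimately have "p t * (1 - 1 / r + (t\<^sup>2 - (s t)\<^sup>2) / 2) \<le> p t * ln (f t)"
    using law.pos[of t] by (intro mult_left_mono) auto
  moreover have "p t * (1 / r) = std_normal_density (s t)"
    using law.pos[of t] by (simp add: r_def)
  ultimately show ?thesis
    unfolding H'_def by (simp add: power2_eq_square field_simps)
qed

lemma integrable_p_mult:
  assumes [measurable]: "h \<in> borel_measurable borel" and h: "\<And>t. \<bar>h t\<bar> \<le> C"
  shows "integrable lborel (\<lambda>t. p t * h t)"
proof -
  have "integrable (density lborel p) h"
    by (rule law.integrable_const_bound[where B = C]) (use h in auto)
  then show ?thesis
    by (subst (asm) integrable_density) (auto simp: law.pos less_imp_le)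
qed

lemma integrable_cost: "integrable lborel (\<lambda>t. p t * (s t - t)\<^sup>2)"
proof (rule integrable_p_mult)
  show "\<bar>(s t - t)\<^sup>2\<bar> \<le> K\<^sup>2" for t
    using s_bounds[of t] K_nonneg by (simp add: abs_le_square_iff[symmetric])
qed simp

lemma integrable_entropy: "integrable lborel (\<lambda>t. p t * ln (f t))"
proof (rule Bochner_Integration.integrable_bound)
  show "integrable lborel (\<lambda>t. std_normal_density t * exp (2 * K * \<bar>t\<bar>) + std_normal_density t)"
    using integrable_normal_exp_abs[of "2 * K"] by (intro Bochner_Integration.integrable_add) auto
  show "AE t in lborel. norm (p t * ln (f t))
      \<le> norm (std_normal_density t * exp (2 * K * \<bar>t\<bar>) + std_normal_density t)"
  proof (rule AE_I2)
    fix t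
    have "\<bar>f t * ln (f t)\<bar> \<le> (f t)\<^sup>2 + 1" by (rule abs_mult_ln_le[OF f_pos])
    also have "(f t)\<^sup>2 \<le> (exp (K * \<bar>t\<bar>))\<^sup>2"
      using f_le f_pos[of t] by (intro power_mono) auto
    also have "\<dots> = exp (2 * K * \<bar>t\<bar>)" by (simp add: exp_double[symmetric] mult.assoc)
    finally have "std_normal_density t * \<bar>f t * ln (f t)\<bar> \<le> std_normal_density t * (exp (2 * K * \<bar>t\<bar>) + 1)"
      by (intro mult_left_mono) auto
    then show "norm (p t * ln (f t)) \<le> norm (std_normal_density t * exp (2 * K * \<bar>t\<bar>) + std_normal_density t)"
      by (simp add: p_eq abs_mult mult.assoc distrib_left)
  qed
qed simp

text \<open>Talagrand's inequality on the line: integrating \<open>entropy_pointwise\<close> removes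
  \<open>H'\<close>.\<close>

lemma transport_entropy_real:
  "(\<integral>t. p t * (s t - t)\<^sup>2 \<partial>lborel) \<le> 2 * (\<integral>t. p t * ln (f t) \<partial>lborel)"
proof -
  note i = integrable_cost
  have "(\<integral>t. p t * (s t - t)\<^sup>2 / 2 - H' t \<partial>lborel) \<le> (\<integral>t. p t * ln (f t) \<partial>lborel)"
    using i integrable_H' by (intro integral_mono integrable_entropy entropy_pointwise) auto
  then show ?thesis
    using i integrable_H' by (simp add: integral_H')
qed


lemma density_f: "density std_normal_distribution f = density lborel p"
  by (subst density_density_eq) (auto simp: p_eq[abs_def] ennreal_mult'' f_pos less_imp_le intro!: density_cong)

lemma distr_s_normal: "distr (density std_normal_distribution f) std_normal_distribution s = std_normal_distribution"
proof -
  have "distr (density lborel p) std_normal_distribution s = distr (density lborel p) borel s"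
    by (rule distr_cong) auto
  then show ?thesis by (simp add: density_f distr_s)
qed

lemma integrable_f: "integrable std_normal_distribution f"
  and integral_f: "integral\<^sup>L std_normal_distribution f = 1"
proof -
  have "integrable lborel (\<lambda>t. p t * 1)" by (rule integrable_p_mult[where C = 1]) auto
  then show "integrable std_normal_distribution f"
    by (subst integrable_density) (auto simp: p_eq)
  have "integral\<^sup>L std_normal_distribution f = integral\<^sup>L lborel p"
    by (subst integral_density) (auto simp: p_eq[abs_def])
  also have "\<dots> = integral\<^sup>L (density lborel p) (\<lambda>_. 1)"
    by (subst integral_density) (auto simp: law.pos less_imp_le)
  finally show "integral\<^sup>L std_normal_distribution f = 1" using law.prob_space by simp
qed

lemma integrable_entropy_normal: "integrable std_normal_distribution (\<lambda>t. f t * ln (f t))"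
  using integrable_entropy by (subst integrable_density) (auto simp: p_eq mult.assoc)

lemma integrable_cost_normal: "integrable std_normal_distribution (\<lambda>t. f t * (s t - t)\<^sup>2)"
  using integrable_cost by (subst integrable_density) (auto simp: p_eq mult.assoc)

lemma transport_entropy_normal:
  "(\<integral>t. f t * (s t - t)\<^sup>2 \<partial>std_normal_distribution) \<le> 2 * (\<integral>t. f t * ln (f t) \<partial>std_normal_distribution)"
  using transport_entropy_real by (subst (1 2) integral_density) (auto simp: p_eq mult.assoc)

end

section \<open>Tensorization by the Knothe map\<close>

text \<open>Tested on rectangles. For fixed \<open>x\<close> the inner integral over
  \<open>t\<close> is \<open>emeasure B T\<close> whatever \<open>x\<close> is, because
  \<open>s x\<close> transports the conditional law; what remains is the push-forward under
  \<open>S\<close>. The new coordinate \<open>t\<close> comes first in the pair, although it is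
  moved depending on \<open>x\<close>.\<close>

lemma distr_triangular_map:
  fixes F :: "'b \<Rightarrow> ennreal"
  assumes A: "sigma_finite_measure A" and B: "sigma_finite_measure B"
    and [measurable]: "F \<in> borel_measurable A" "(\<lambda>(t, x). g x t) \<in> borel_measurable (B \<Otimes>\<^sub>M A)"
      "S \<in> measurable A A" "(\<lambda>(t, x). s x t) \<in> measurable (B \<Otimes>\<^sub>M A) B"
    and S: "distr (density A F) A S = A"
    and s: "\<And>x. x \<in> space A \<Longrightarrow> distr (density B (g x)) B (s x) = B"
  shows "distr (density (B \<Otimes>\<^sub>M A) (\<lambda>(t, x). F x * g x t)) (B \<Otimes>\<^sub>M A) (\<lambda>(t, x). (s x t, S x)) = B \<Otimes>\<^sub>M A"
proof (rule pair_measure_eqI[OF B A, symmetric])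
  interpret pair_sigma_finite B A using A B by (intro pair_sigma_finite.intro)
  fix T U assume [measurable]: "T \<in> sets B" "U \<in> sets A"
  let ?D = "distr (density (B \<Otimes>\<^sub>M A) (\<lambda>(t, x). F x * g x t)) (B \<Otimes>\<^sub>M A) (\<lambda>(t, x). (s x t, S x))"
  have "emeasure ?D (T \<times> U) = (\<integral>\<^sup>+z. indicator (T \<times> U) z \<partial>?D)"
    by simp
  also have "\<dots> = (\<integral>\<^sup>+z. (case z of (t, x) \<Rightarrow> F x * g x t) * indicator (T \<times> U) (case z of (t, x) \<Rightarrow> (s x t, S x)) \<partial>(B \<Otimes>\<^sub>M A))"
    by (subst nn_integral_distr, measurable, subst nn_integral_density) auto
  also have "\<dots> = (\<integral>\<^sup>+x. \<integral>\<^sup>+t. F x * g x t * indicator (T \<times> U) (s x t, S x) \<partial>B \<partial>A)"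
    by (subst nn_integral_snd[symmetric]) auto
  also have "\<dots> = (\<integral>\<^sup>+x. F x * indicator U (S x) * (\<integral>\<^sup>+t. g x t * indicator T (s x t) \<partial>B) \<partial>A)"
    by (intro nn_integral_cong, subst nn_integral_cmult[symmetric])
      (auto intro!: nn_integral_cong split: split_indicator)
  also have "\<dots> = (\<integral>\<^sup>+x. F x * indicator U (S x) * emeasure B T \<partial>A)"
  proof (rule nn_integral_cong)
    fix x assume x [measurable]: "x \<in> space A"
    have "(\<integral>\<^sup>+t. g x t * indicator T (s x t) \<partial>B) = (\<integral>\<^sup>+u. indicator T u \<partial>distr (density B (g x)) B (s x))"
      by (subst nn_integral_distr, measurable, subst nn_integral_density) auto
    then show "F x * indicator U (S x) * (\<integral>\<^sup>+t. g x t * indicator T (s x t) \<partial>B) = F x * indicator U (S x) * emeasure B T"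
      using s[OF x] by simp
  qed
  also have "\<dots> = (\<integral>\<^sup>+u. indicator U u \<partial>distr (density A F) A S) * emeasure B T"
    by (subst nn_integral_distr, measurable, subst nn_integral_density) (auto simp: nn_integral_multc)
  finally show "emeasure B T * emeasure A U = emeasure ?D (T \<times> U)"
    unfolding S by (simp add: mult.commute)
qed simp

text \<open>Since \<open>g x\<close> integrates to 1 over \<open>t\<close>, both cost and entropy
  split into the part of \<open>F\<close> and the \<open>F\<close>-average of the conditional part;
  the inequality then holds for each part.\<close>

lemma entropy_chain_rule_le:
  fixes F :: "'b \<Rightarrow> real" and g :: "'b \<Rightarrow> 'c \<Rightarrow> real"
  assumes A: "sigma_finite_measure A" and B: "sigma_finite_measure B"
    and F: "\<And>x. x \<in> space A \<Longrightarrow> 0 < F x" and g: "\<And>x t. x \<in> space A \<Longrightarrow> t \<in> space B \<Longrightarrow> 0 < g x t"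
    and ig: "\<And>x. x \<in> space A \<Longrightarrow> integrable B (g x)" "\<And>x. x \<in> space A \<Longrightarrow> integral\<^sup>L B (g x) = 1"
    and ie: "\<And>x. x \<in> space A \<Longrightarrow> integrable B (\<lambda>t. g x t * ln (g x t))"
    and id: "\<And>x. x \<in> space A \<Longrightarrow> integrable B (\<lambda>t. g x t * d x t)"
    and gd: "\<And>x. x \<in> space A \<Longrightarrow> (\<integral>t. g x t * d x t \<partial>B) \<le> 2 * (\<integral>t. g x t * ln (g x t) \<partial>B)"
    and iF: "integrable A (\<lambda>x. F x * ln (F x))" "integrable A (\<lambda>x. F x * e x)"
    and Fe: "(\<integral>x. F x * e x \<partial>A) \<le> 2 * (\<integral>x. F x * ln (F x) \<partial>A)"
    and ih: "integrable (B \<Otimes>\<^sub>M A) (\<lambda>(t, x). F x * g x t * ln (F x * g x t))"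
    and ihe: "integrable (B \<Otimes>\<^sub>M A) (\<lambda>(t, x). F x * g x t * (e x + d x t))"
  shows "(\<integral>(t, x). F x * g x t * (e x + d x t) \<partial>(B \<Otimes>\<^sub>M A))
    \<le> 2 * (\<integral>(t, x). F x * g x t * ln (F x * g x t) \<partial>(B \<Otimes>\<^sub>M A))"
proof -
  interpret pair_sigma_finite B A using A B by (intro pair_sigma_finite.intro)
  let ?E = "\<lambda>x. \<integral>t. g x t * ln (g x t) \<partial>B" and ?D = "\<lambda>x. \<integral>t. g x t * d x t \<partial>B"
  have 1: "(\<integral>t. F x * g x t * (e x + d x t) \<partial>B) = F x * e x + F x * ?D x" if "x \<in> space A" for x
  proof -
    have "(\<lambda>t. F x * g x t * (e x + d x t)) = (\<lambda>t. F x * e x * g x t + F x * (g x t * d x t))"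
      by (simp add: fun_eq_iff algebra_simps)
    then show ?thesis using ig id that by simp
  qed
  have 2: "(\<integral>t. F x * g x t * ln (F x * g x t) \<partial>B) = F x * ln (F x) + F x * ?E x" if "x \<in> space A" for x
  proof -
    have "(\<integral>t. F x * g x t * ln (F x * g x t) \<partial>B) = (\<integral>t. F x * ln (F x) * g x t + F x * (g x t * ln (g x t)) \<partial>B)"
      using F[OF that] g[OF that] by (intro Bochner_Integration.integral_cong) (auto simp: ln_mult algebra_simps)
    then show ?thesis using ig ie that by simp
  qed
  have i1: "integrable A (\<lambda>x. F x * e x + F x * ?D x)"
    using integrable_snd[OF ihe] by (simp add: 1 cong: Bochner_Integration.integrable_cong)
  have i2: "integrable A (\<lambda>x. F x * ln (F x) + F x * ?E x)"
    using integrable_snd[OF ih] by (simp add: 2 cong: Bochner_Integration.integrable_cong)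
  \<comment> \<open>Nothing is assumed directly about the averaged conditional terms; subtracting
    the known part from the Fubini marginal makes them integrable.\<close>
  have D: "integrable A (\<lambda>x. F x * ?D x)"
    using Bochner_Integration.integrable_diff[OF i1 iF(2)] by simp
  have E: "integrable A (\<lambda>x. F x * ?E x)"
    using Bochner_Integration.integrable_diff[OF i2 iF(1)] by simp
  have "(\<integral>(t, x). F x * g x t * (e x + d x t) \<partial>(B \<Otimes>\<^sub>M A)) = (\<integral>x. F x * e x + F x * ?D x \<partial>A)"
    using integral_snd[OF ihe] by (simp add: 1 cong: Bochner_Integration.integral_cong)
  also have "\<dots> = (\<integral>x. F x * e x \<partial>A) + (\<integral>x. F x * ?D x \<partial>A)"
    using iF D by simp
  also have "(\<integral>x. F x * ?D x \<partial>A) \<le> (\<integral>x. 2 * (F x * ?E x) \<partial>A)"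
  proof (rule integral_mono)
    show "F x * ?D x \<le> 2 * (F x * ?E x)" if "x \<in> space A" for x
      using mult_left_mono[OF gd[OF that], of "F x"] F[OF that] by simp
  qed (use D E in auto)
  also have "(\<integral>x. F x * e x \<partial>A) + (\<integral>x. 2 * (F x * ?E x) \<partial>A)
      \<le> 2 * (\<integral>x. F x * ln (F x) \<partial>A) + 2 * (\<integral>x. F x * ?E x \<partial>A)"
    using Fe by simp
  also have "\<dots> = 2 * (\<integral>x. F x * ln (F x) + F x * ?E x \<partial>A)"
    using iF E by simp
  also have "(\<integral>x. F x * ln (F x) + F x * ?E x \<partial>A) = (\<integral>(t, x). F x * g x t * ln (F x * g x t) \<partial>(B \<Otimes>\<^sub>M A))"
    using integral_snd[OF ih] by (simp add: 2 cong: Bochner_Integration.integral_cong)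
  finally show ?thesis by simp
qed

section \<open>Smoothing finitely many coordinates, and the induction over them\<close>

locale bounded_family = prob_space +
  fixes Y :: "'i \<Rightarrow> 'a \<Rightarrow> real" and K :: real
  assumes measurable_Y [measurable]: "\<And>i. Y i \<in> borel_measurable M"
    and bounded_Y: "\<And>i \<omega>. \<omega> \<in> space M \<Longrightarrow> \<bar>Y i \<omega>\<bar> \<le> K"
begin

sublocale rv: bounded_rv M "Y i" K for i
  by unfold_locales (auto intro: bounded_Y)

text \<open>The log-likelihood ratio at \<open>x\<close> of the Gaussian with mean
  \<open>Y i \<omega>\<close> in coordinates \<open>i\<close> of \<open>I\<close> against the
  standard one. Its averaged exponential \<open>F I\<close> is the density of the corresponding
  coordinates of \<open>Y + Z\<close> relative to \<open>G I\<close>.\<close>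

definition L :: "'i set \<Rightarrow> ('i \<Rightarrow> real) \<Rightarrow> 'a \<Rightarrow> real" where
  "L I x \<omega> = (\<Sum>i\<in>I. x i * Y i \<omega> - (Y i \<omega>)\<^sup>2 / 2)"

definition F :: "'i set \<Rightarrow> ('i \<Rightarrow> real) \<Rightarrow> real" where
  "F I x = (\<integral>\<omega>. exp (L I x \<omega>) \<partial>M)"

abbreviation G :: "'i set \<Rightarrow> ('i \<Rightarrow> real) measure" where
  "G I \<equiv> (\<Pi>\<^sub>M i\<in>I. std_normal_distribution)"

text \<open>\<open>cond I x\<close> is the law of the underlying \<open>\<omega>\<close> given \<open>Y i \<omega> + Z i = x i\<close> for all \<open>i \<in> I\<close>;
  under it the remaining coordinates are still Gaussian smoothings of the bounded \<open>Y i\<close>.\<close>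

definition cond :: "'i set \<Rightarrow> ('i \<Rightarrow> real) \<Rightarrow> 'a measure" where
  "cond I x = density M (\<lambda>\<omega>. exp (L I x \<omega>) / F I x)"

text \<open>One component of the Knothe map: the rearrangement of the conditional law of coordinate
  \<open>i\<close> given the values \<open>x\<close> on \<open>I\<close>.\<close>

definition step :: "'i set \<Rightarrow> 'i \<Rightarrow> ('i \<Rightarrow> real) \<Rightarrow> real \<Rightarrow> real" where
  "step I i x = bounded_rv.s (cond I x) (Y i)"

lemma sets_G [measurable_cong]: "sets (G I) = sets (\<Pi>\<^sub>M i\<in>I. borel)"
  by (rule sets_PiM_cong) auto

lemma measurable_L_pair [measurable]: "(\<lambda>(x, \<omega>). L I x \<omega>) \<in> borel_measurable (G I \<Otimes>\<^sub>M M)"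
  unfolding L_def split_beta' by measurable

lemma measurable_L [measurable]: "L I x \<in> borel_measurable M"
  unfolding L_def[abs_def] by measurable

lemma measurable_F [measurable]: "F I \<in> borel_measurable (G I)"
  unfolding F_def[abs_def] by measurable

lemma L_le:
  assumes "\<omega> \<in> space M" shows "L I x \<omega> \<le> (\<Sum>i\<in>I. K * \<bar>x i\<bar>)"
  unfolding L_def by (intro sum_mono rv.exponent_le assms)

lemma integrable_L: "integrable M (\<lambda>\<omega>. exp (L I x \<omega>))"
  by (rule integrable_const_bound[where B = "exp (\<Sum>i\<in>I. K * \<bar>x i\<bar>)"]) (auto intro!: L_le)

lemma F_pos: "0 < F I x"
proof -
  have "F I x \<noteq> 0"
  proof
    assume "F I x = 0"
    then have "AE \<omega> in M. exp (L I x \<omega>) = 0"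
      unfolding F_def by (subst (asm) integral_nonneg_eq_0_iff_AE[OF integrable_L]) auto
    then show False by simp
  qed
  moreover have "0 \<le> F I x" unfolding F_def by (intro Bochner_Integration.integral_nonneg) simp
  ultimately show ?thesis by simp
qed

lemma F_le: "F I x \<le> exp (\<Sum>i\<in>I. K * \<bar>x i\<bar>)"
proof -
  have "F I x \<le> (\<integral>\<omega>. exp (\<Sum>i\<in>I. K * \<bar>x i\<bar>) \<partial>M)"
    unfolding F_def by (intro integral_mono_AE integrable_L) (auto intro!: AE_I2 L_le)
  then show ?thesis by (simp add: prob_space)
qed

lemma F_empty: "F {} x = 1"
  by (simp add: F_def L_def prob_space)

lemma L_insert:
  assumes "finite I" "i \<notin> I"
  shows "L (insert i I) (x(i := t)) \<omega> = L I x \<omega> + (t * Y i \<omega> - (Y i \<omega>)\<^sup>2 / 2)"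
  using assms unfolding L_def by (auto intro!: sum.cong)

text \<open>\<open>F I x\<close> is the normalising constant of the weight, and reweighting leaves
  the pointwise bound \<open>K\<close> untouched.\<close>

lemma bounded_rv_cond: "bounded_rv (cond I x) (Y i) K"
proof -
  have "prob_space (cond I x)"
  proof
    have "emeasure (cond I x) (space (cond I x)) = (\<integral>\<^sup>+\<omega>. exp (L I x \<omega>) / F I x \<partial>M)"
      unfolding cond_def by (simp add: emeasure_density cong: nn_integral_cong)
    also have "\<dots> = ennreal (\<integral>\<omega>. exp (L I x \<omega>) / F I x \<partial>M)"
      using F_pos[of I x] integrable_L by (intro nn_integral_eq_integral) auto
    also have "(\<integral>\<omega>. exp (L I x \<omega>) / F I x \<partial>M) = 1"
      using F_pos[of I x] by (simp add: F_def)
    finally show "emeasure (cond I x) (space (cond I x)) = 1" by simp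
  qed
  then show ?thesis
    by (intro bounded_rv.intro bounded_rv_axioms.intro) (auto simp: cond_def bounded_Y)
qed

sublocale c: bounded_rv "cond I x" "Y i" K for I x i
  by (rule bounded_rv_cond)

text \<open>Bayes' formula: a conditional density is the joint density over the marginal
  one.\<close>

lemma cond_f:
  assumes "finite I" "i \<notin> I"
  shows "c.f I x i t = F (insert i I) (x(i := t)) / F I x"
proof -
  have "c.f I x i t = (\<integral>\<omega>. exp (L I x \<omega>) / F I x * exp (t * Y i \<omega> - (Y i \<omega>)\<^sup>2 / 2) \<partial>M)"
    unfolding c.f_def using F_pos[of I x] unfolding cond_def by (subst integral_density) auto
  also have "\<dots> = (\<integral>\<omega>. exp (L (insert i I) (x(i := t)) \<omega>) / F I x \<partial>M)"
    by (simp add: L_insert[OF assms] exp_add)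
  finally show ?thesis by (simp add: F_def)
qed

lemma step_bounds: "\<bar>step I i x t - t\<bar> \<le> K"
  unfolding step_def by (rule c.s_bounds)

lemma measurable_upd [measurable]: "(\<lambda>(t, x). x(i := t)) \<in> measurable (std_normal_distribution \<Otimes>\<^sub>M G I) (G (insert i I))"
  by measurable

lemma measurable_F_upd [measurable]: "(\<lambda>(t, x). F (insert i I) (x(i := t))) \<in> borel_measurable (std_normal_distribution \<Otimes>\<^sub>M G I)"
  using measurable_compose[OF measurable_upd measurable_F, of i I] by (simp add: split_beta')

text \<open>The inverse function hides the dependence on \<open>x\<close>, but the sublevel
  condition \<open>step I i x t \<le> a\<close> means that the conditional distribution function at
  \<open>t\<close> is at most \<open>normal_cdf a\<close>, and that function is an explicit integral
  depending measurably on its parameters.\<close>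

lemma measurable_step:
  assumes I: "finite I" "i \<notin> I"
  shows "(\<lambda>(t, x). step I i x t) \<in> borel_measurable (std_normal_distribution \<Otimes>\<^sub>M G I)"
proof (rule borel_measurable_iff_le[THEN iffD2], rule allI)
  fix a :: real
  have p: "c.p I x i u = std_normal_density u * (F (insert i I) (x(i := u)) / F I x)" for x u
    by (simp add: c.p_eq cond_f[OF I])
  have P: "c.law.P I x i t = (\<integral>u. indicator {..t} u * (std_normal_density u * (F (insert i I) (x(i := u)) / F I x)) \<partial>lborel)"
    if "x \<in> space (G I)" for x t
  proof -
    have "c.law.P I x i t = (\<integral>u. indicator {..t} u \<partial>density lborel (c.p I x i))"
      by (simp add: cdf_def)
    also have "\<dots> = (\<integral>u. c.p I x i u * indicator {..t} u \<partial>lborel)"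
      by (subst integral_density) (auto simp: c.p_pos less_imp_le)
    finally show ?thesis by (simp add: p mult.commute)
  qed
  have [measurable]: "(\<lambda>z. F (insert i I) ((snd (fst z))(i := snd z)))
     \<in> borel_measurable ((std_normal_distribution \<Otimes>\<^sub>M G I) \<Otimes>\<^sub>M lborel)"
  proof -
    have "(\<lambda>(w, u). (u, snd w)) \<in> measurable ((std_normal_distribution \<Otimes>\<^sub>M G I) \<Otimes>\<^sub>M lborel) (std_normal_distribution \<Otimes>\<^sub>M G I)"
      by measurable
    from measurable_compose[OF this measurable_F_upd[of i I]] show ?thesis
      by (simp add: split_beta')
  qed
  have "(\<lambda>w. \<integral>u. indicator {..fst w} u * (std_normal_density u * (F (insert i I) ((snd w)(i := u)) / F I (snd w))) \<partial>lborel)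
     \<in> borel_measurable (std_normal_distribution \<Otimes>\<^sub>M G I)"
    \<comment> \<open>The set \<open>{..fst w}\<close> varies with the parameter, so its indicator
      is turned into a comparison of two measurable functions.\<close>
    unfolding indicator_def atMost_iff by measurable
  then have "{w \<in> space (std_normal_distribution \<Otimes>\<^sub>M G I).
      (\<integral>u. indicator {..fst w} u * (std_normal_density u * (F (insert i I) ((snd w)(i := u)) / F I (snd w))) \<partial>lborel)
      \<le> normal_cdf a} \<in> sets (std_normal_distribution \<Otimes>\<^sub>M G I)"
    by measurable
  also have "?this \<longleftrightarrow> {w \<in> space (std_normal_distribution \<Otimes>\<^sub>M G I).
      (case w of (t, x) \<Rightarrow> step I i x t) \<le> a} \<in> sets (std_normal_distribution \<Otimes>\<^sub>M G I)"
    by (intro arg_cong2[where f = "(\<in>)"] refl Collect_cong)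
      (auto simp: step_def c.s_le_iff P space_pair_measure)
  finally show "{w \<in> space (std_normal_distribution \<Otimes>\<^sub>M G I).
      (case w of (t, x) \<Rightarrow> step I i x t) \<le> a} \<in> sets (std_normal_distribution \<Otimes>\<^sub>M G I)" .
qed

text \<open>\<open>F_le\<close> bounds the squared density by a product of one-coordinate
  exponentials, which is integrable factor by factor.\<close>

lemma integrable_F_entropy:
  assumes "finite I"
  shows "integrable (G I) (\<lambda>x. F I x * ln (F I x))"
proof (rule Bochner_Integration.integrable_bound)
  interpret product_prob_space "\<lambda>_. std_normal_distribution" I
    by (intro product_prob_spaceI normal.prob_space_axioms)
  interpret GI: prob_space "G I" by (intro prob_space_PiM normal.prob_space_axioms)
  have "integrable std_normal_distribution (\<lambda>t. exp (2 * K * \<bar>t\<bar>))"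
    using integrable_normal_exp_abs by (subst integrable_density) auto
  then have "integrable (G I) (\<lambda>x. \<Prod>i\<in>I. exp (2 * K * \<bar>x i\<bar>))"
    by (intro product_integrable_prod assms)
  then show "integrable (G I) (\<lambda>x. (\<Prod>i\<in>I. exp (2 * K * \<bar>x i\<bar>)) + 1)"
    by (intro Bochner_Integration.integrable_add) auto
  show "AE x in G I. norm (F I x * ln (F I x)) \<le> norm ((\<Prod>i\<in>I. exp (2 * K * \<bar>x i\<bar>)) + 1)"
  proof (rule AE_I2)
    fix x
    have "\<bar>F I x * ln (F I x)\<bar> \<le> (F I x)\<^sup>2 + 1" by (rule abs_mult_ln_le[OF F_pos])
    also have "(F I x)\<^sup>2 \<le> (exp (\<Sum>i\<in>I. K * \<bar>x i\<bar>))\<^sup>2"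
      using F_le F_pos[of I x] by (intro power_mono) auto
    also have "\<dots> = (\<Prod>i\<in>I. exp (2 * K * \<bar>x i\<bar>))"
      by (simp add: exp_double[symmetric] exp_sum[OF assms, symmetric] sum_distrib_left mult.assoc)
    finally show "norm (F I x * ln (F I x)) \<le> norm ((\<Prod>i\<in>I. exp (2 * K * \<bar>x i\<bar>)) + 1)"
      by simp
  qed
qed simp

text \<open>Talagrand's inequality for the product, by induction on \<open>I\<close>. The pointwise
  displacement bound is carried along because it makes the cost integrable, as the chain rule
  requires.\<close>

lemma transport_entropy_PiM:
  assumes "finite I"
  shows "\<exists>S \<in> measurable (G I) (G I).
     distr (density (G I) (F I)) (G I) S = G I
   \<and> (\<forall>x\<in>space (G I). \<forall>i\<in>I. \<bar>S x i - x i\<bar> \<le> K)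
   \<and> (\<integral>x. F I x * (\<Sum>i\<in>I. (S x i - x i)\<^sup>2) \<partial>G I) \<le> 2 * (\<integral>x. F I x * ln (F I x) \<partial>G I)"
  using assms
proof induction
  case empty
  have "density (G {}) (F {}) = G {}"
    using density_1 by (simp add: F_empty[abs_def])
  then show ?case
    by (intro bexI[where x = "\<lambda>x. x"]) (auto simp: F_empty distr_id2)
next
  case (insert i I)
  let ?N = "std_normal_distribution"
  let ?J = "insert i I"
  obtain S where [measurable]: "S \<in> measurable (G I) (G I)"
    and S: "distr (density (G I) (F I)) (G I) S = G I"
    and Sb: "\<And>x j. x \<in> space (G I) \<Longrightarrow> j \<in> I \<Longrightarrow> \<bar>S x j - x j\<bar> \<le> K"
    and Sc: "(\<integral>x. F I x * (\<Sum>j\<in>I. (S x j - x j)\<^sup>2) \<partial>G I) \<le> 2 * (\<integral>x. F I x * ln (F I x) \<partial>G I)"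
    using insert.IH by blast
  note [measurable] = measurable_step[OF insert.hyps]
  have G: "prob_space (G I')" for I' :: "'i set"
    by (intro prob_space_PiM normal.prob_space_axioms)
  interpret GI: prob_space "G I" by (rule G)
  interpret pair_prob_space ?N "G I" by unfold_locales
  define u where "u = (\<lambda>(t::real, x::'i \<Rightarrow> real). x(i := t))"
  have [measurable]: "u \<in> measurable (?N \<Otimes>\<^sub>M G I) (G ?J)"
    unfolding u_def by measurable
  have Gu: "G ?J = distr (?N \<Otimes>\<^sub>M G I) (G ?J) u"
    unfolding u_def by (rule distr_pair_PiM_eq_PiM[symmetric]) (rule normal.prob_space_axioms)+
  define g where "g x t = F ?J (x(i := t)) / F I x" for x t
  have g: "g x = c.f I x i" for x
    by (rule ext) (simp add: g_def cond_f[OF insert.hyps])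
  have Fg: "F I x * g x t = F ?J (u (t, x))" for x t
    using F_pos[of I x] by (simp add: g_def u_def)
  have [measurable]: "(\<lambda>(t, x). g x t) \<in> borel_measurable (?N \<Otimes>\<^sub>M G I)"
    unfolding g_def by measurable
  \<comment> \<open>Restriction resets coordinate \<open>i\<close> to \<open>undefined\<close>, so
    that on the image of \<open>u\<close> it returns exactly the point \<open>x\<close> of the
    smaller product space.\<close>
  define S' where "S' y = (S (restrict y I))(i := step I i (restrict y I) (y i))" for y
  have [measurable]: "S' \<in> measurable (G ?J) (G ?J)"
  proof -
    have r: "(\<lambda>y. restrict y I) \<in> measurable (G ?J) (G I)"
      by (rule measurable_restrict_subset) auto
    then have "(\<lambda>y. (y i, restrict y I)) \<in> measurable (G ?J) (?N \<Otimes>\<^sub>M G I)"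
      by (intro measurable_Pair) auto
    from measurable_compose[OF this measurable_step[OF insert.hyps]]
    have st: "(\<lambda>y. step I i (restrict y I) (y i)) \<in> measurable (G ?J) ?N"
      by simp
    show ?thesis
      unfolding S'_def
      by (rule measurable_fun_upd[where J = I]) (auto intro: st measurable_compose[OF r])
  qed
  have S'u: "S' (u (t, x)) = u (step I i x t, S x)" if "x \<in> space (G I)" for t x
  proof -
    have "restrict (x(i := t)) I = x"
      using that insert.hyps(2) by (auto simp: space_PiM PiE_def extensional_def restrict_def fun_eq_iff)
    then show ?thesis by (simp add: S'_def u_def)
  qed
  have T: "distr (density (?N \<Otimes>\<^sub>M G I) (\<lambda>(t, x). ennreal (F I x) * ennreal (g x t))) (?N \<Otimes>\<^sub>M G I)
      (\<lambda>(t, x). (step I i x t, S x)) = ?N \<Otimes>\<^sub>M G I"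
  proof (rule distr_triangular_map)
    show "distr (density ?N (\<lambda>t. ennreal (g x t))) ?N (step I i x) = ?N" for x
      unfolding g step_def by (rule c.distr_s_normal)
  qed (use S in \<open>auto intro: sigma_finite_measure_axioms GI.sigma_finite_measure_axioms normal.sigma_finite_measure_axioms\<close>)
  have dens: "(\<lambda>(t, x). ennreal (F I x) * ennreal (g x t)) = (\<lambda>z. ennreal (F ?J (u z)))"
    using F_pos by (auto simp: fun_eq_iff Fg[symmetric] ennreal_mult' less_imp_le)
  have law: "distr (density (G ?J) (F ?J)) (G ?J) S' = G ?J"
  proof -
    have "distr (density (G ?J) (F ?J)) (G ?J) S'
        = distr (density (distr (?N \<Otimes>\<^sub>M G I) (G ?J) u) (F ?J)) (G ?J) S'"
      by (simp flip: Gu)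
    also have "\<dots> = distr (distr (density (?N \<Otimes>\<^sub>M G I) (\<lambda>z. F ?J (u z))) (G ?J) u) (G ?J) S'"
      by (subst density_distr) auto
    also have "\<dots> = distr (density (?N \<Otimes>\<^sub>M G I) (\<lambda>z. F ?J (u z))) (G ?J) (S' \<circ> u)"
      by (rule distr_distr) auto
    also have "\<dots> = distr (density (?N \<Otimes>\<^sub>M G I) (\<lambda>z. F ?J (u z))) (G ?J)
        (u \<circ> (\<lambda>(t, x). (step I i x t, S x)))"
      by (rule distr_cong) (auto simp: S'u space_pair_measure)
    also have "\<dots> = distr (distr (density (?N \<Otimes>\<^sub>M G I) (\<lambda>z. F ?J (u z))) (?N \<Otimes>\<^sub>M G I)
        (\<lambda>(t, x). (step I i x t, S x))) (G ?J) u"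
      by (rule distr_distr[symmetric]) auto
    also have "\<dots> = G ?J"
      unfolding T[unfolded dens] by (rule Gu[symmetric])
    finally show ?thesis .
  qed
  \<comment> \<open>The total mass of the density \<open>F J\<close> is read off from its
    push-forward \<open>G J\<close>; bounded functions are then integrable against it.\<close>
  have dist_F: "integrable (G J) (\<lambda>x. F J x * h x)"
    if "distr (density (G J) (F J)) (G J) R = G J" "R \<in> measurable (G J) (G J)"
      and [measurable]: "h \<in> borel_measurable (G J)" and h: "\<And>x. x \<in> space (G J) \<Longrightarrow> \<bar>h x\<bar> \<le> C" for J R h C
  proof -
    have "prob_space (density (G J) (F J))"
    proof
      have "emeasure (distr (density (G J) (F J)) (G J) R) (space (G J)) = 1"
        unfolding that(1) using prob_space.emeasure_space_1[OF G] .
      moreover have "R -` space (G J) \<inter> space (G J) = space (G J)"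
        using measurable_space[OF that(2)] by auto
      ultimately show "emeasure (density (G J) (F J)) (space (density (G J) (F J))) = 1"
        using that(2) by (simp add: emeasure_distr)
    qed
    then have "integrable (density (G J) (F J)) h"
      by (intro finite_measure.integrable_const_bound[where B = C] prob_space.finite_measure) (use h in auto)
    then show ?thesis
      by (subst (asm) integrable_density) (auto simp: F_pos less_imp_le)
  qed
  have K: "0 \<le> K" using rv.K_nonneg .
  have sq: "(a - b)\<^sup>2 \<le> K\<^sup>2" if "\<bar>a - b\<bar> \<le> K" for a b
    using that K by (simp add: abs_le_square_iff[symmetric])
  have bd: "\<bar>\<Sum>j\<in>J. (R y j - y j)\<^sup>2\<bar> \<le> real (card J) * K\<^sup>2"
    if "\<And>j. j \<in> J \<Longrightarrow> \<bar>R y j - y j\<bar> \<le> K" for J and R :: "('i \<Rightarrow> real) \<Rightarrow> 'i \<Rightarrow> real" and y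
  proof -
    have "\<bar>\<Sum>j\<in>J. (R y j - y j)\<^sup>2\<bar> = (\<Sum>j\<in>J. (R y j - y j)\<^sup>2)" by (simp add: sum_nonneg)
    also have "\<dots> \<le> real (card J) * K\<^sup>2" using sq that by (intro sum_bounded_above) auto
    finally show ?thesis .
  qed
  have S'b: "\<bar>S' y j - y j\<bar> \<le> K" if y: "y \<in> space (G ?J)" and j: "j \<in> ?J" for y j
  proof -
    have "restrict y I \<in> space (G I)" by (auto simp: space_PiM)
    then show ?thesis
      using Sb[of "restrict y I" j] step_bounds j by (auto simp: S'_def)
  qed
  have cost: "(\<Sum>j\<in>?J. (S' (u (t, x)) j - u (t, x) j)\<^sup>2) = (\<Sum>j\<in>I. (S x j - x j)\<^sup>2) + (step I i x t - t)\<^sup>2"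
    if "x \<in> space (G I)" for t x
  proof -
    have "(\<Sum>j\<in>I. (u (step I i x t, S x) j - u (t, x) j)\<^sup>2) = (\<Sum>j\<in>I. (S x j - x j)\<^sup>2)"
      using insert.hyps(2) by (intro sum.cong) (auto simp: u_def)
    then show ?thesis
      using insert.hyps by (simp add: S'u[OF that]) (simp add: u_def)
  qed
  have meas_comp: "(\<lambda>y. R y j) \<in> borel_measurable (G J)" if "R \<in> measurable (G J) (G J)" "j \<in> J" for R J j
    using measurable_compose[OF that(1) measurable_component_singleton[OF that(2)]] by simp
  have meas_cost: "(\<lambda>y. \<Sum>j\<in>J. (R y j - y j)\<^sup>2) \<in> borel_measurable (G J)" if "R \<in> measurable (G J) (G J)" for R J
    using meas_comp[OF that] meas_comp[of "\<lambda>x. x" J] by (intro borel_measurable_sum borel_measurable_power borel_measurable_diff) auto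
  have iu: "integrable (?N \<Otimes>\<^sub>M G I) (\<lambda>(t, x). h (u (t, x)))"
    and iu': "(\<integral>(t, x). h (u (t, x)) \<partial>(?N \<Otimes>\<^sub>M G I)) = integral\<^sup>L (G ?J) h"
    if "integrable (G ?J) h" for h :: "_ \<Rightarrow> real"
  proof -
    have h [measurable]: "h \<in> borel_measurable (G ?J)" using that by simp
    show "integrable (?N \<Otimes>\<^sub>M G I) (\<lambda>(t, x). h (u (t, x)))"
      using that by (subst (asm) Gu, subst (asm) integrable_distr_eq) (auto simp: split_beta')
    show "(\<integral>(t, x). h (u (t, x)) \<partial>(?N \<Otimes>\<^sub>M G I)) = integral\<^sup>L (G ?J) h"
      by (subst Gu, subst integral_distr) (auto simp: split_beta')
  qed
  have i1: "integrable (G ?J) (\<lambda>y. F ?J y * ln (F ?J y))"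
    using insert.hyps by (intro integrable_F_entropy) auto
  have i2: "integrable (G ?J) (\<lambda>y. F ?J y * (\<Sum>j\<in>?J. (S' y j - y j)\<^sup>2))"
    by (rule dist_F[OF law _ _ bd]) (auto intro!: S'b meas_cost)
  have i3: "integrable (G I) (\<lambda>y. F I y * (\<Sum>j\<in>I. (S y j - y j)\<^sup>2))"
    by (rule dist_F[OF S _ _ bd]) (auto intro!: Sb meas_cost)
  have e2: "F I x * g x t * ((\<Sum>j\<in>I. (S x j - x j)\<^sup>2) + (step I i x t - t)\<^sup>2)
      = F ?J (u (t, x)) * (\<Sum>j\<in>?J. (S' (u (t, x)) j - u (t, x) j)\<^sup>2)" if "x \<in> space (G I)" for t x
    by (simp only: Fg cost[OF that])
  have "(\<integral>(t, x). F I x * g x t * ((\<Sum>j\<in>I. (S x j - x j)\<^sup>2) + (step I i x t - t)\<^sup>2) \<partial>(?N \<Otimes>\<^sub>M G I))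
    \<le> 2 * (\<integral>(t, x). F I x * g x t * ln (F I x * g x t) \<partial>(?N \<Otimes>\<^sub>M G I))"
  proof (rule entropy_chain_rule_le)
    show "(\<integral>x. F I x * (\<Sum>j\<in>I. (S x j - x j)\<^sup>2) \<partial>G I) \<le> 2 * (\<integral>x. F I x * ln (F I x) \<partial>G I)"
      by (rule Sc)
    show "integrable (?N \<Otimes>\<^sub>M G I) (\<lambda>(t, x). F I x * g x t * ln (F I x * g x t))"
      unfolding Fg by (rule iu[OF i1])
    show "integrable (?N \<Otimes>\<^sub>M G I) (\<lambda>(t, x). F I x * g x t * ((\<Sum>j\<in>I. (S x j - x j)\<^sup>2) + (step I i x t - t)\<^sup>2))"
      using iu[OF i2]
      by (rule Bochner_Integration.integrable_cong[THEN iffD1, rotated -1]) (auto simp: e2 space_pair_measure)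
    show "integrable (G I) (\<lambda>x. F I x * ln (F I x))"
      by (rule integrable_F_entropy[OF insert.hyps(1)])
    show "integrable ?N (g x)" "integral\<^sup>L ?N (g x) = 1" for x
      unfolding g by (rule c.integrable_f c.integral_f)+
    show "0 < F I x" "0 < g x t" for x t
      unfolding g by (rule F_pos c.f_pos)+
    show "integrable ?N (\<lambda>t. g x t * ln (g x t))" for x
      unfolding g by (rule c.integrable_entropy_normal)
    show "integrable ?N (\<lambda>t. g x t * (step I i x t - t)\<^sup>2)" for x
      unfolding g step_def by (rule c.integrable_cost_normal)
    show "(\<integral>t. g x t * (step I i x t - t)\<^sup>2 \<partial>?N) \<le> 2 * (\<integral>t. g x t * ln (g x t) \<partial>?N)" for x
      unfolding g step_def by (rule c.transport_entropy_normal)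
  qed (rule i3 GI.sigma_finite_measure_axioms normal.sigma_finite_measure_axioms)+
  also have "(\<integral>(t, x). F I x * g x t * ((\<Sum>j\<in>I. (S x j - x j)\<^sup>2) + (step I i x t - t)\<^sup>2) \<partial>(?N \<Otimes>\<^sub>M G I))
      = (\<integral>(t, x). F ?J (u (t, x)) * (\<Sum>j\<in>?J. (S' (u (t, x)) j - u (t, x) j)\<^sup>2) \<partial>(?N \<Otimes>\<^sub>M G I))"
    by (rule Bochner_Integration.integral_cong) (auto simp: e2 space_pair_measure)
  also have "\<dots> = (\<integral>y. F ?J y * (\<Sum>j\<in>?J. (S' y j - y j)\<^sup>2) \<partial>G ?J)"
    by (rule iu'[OF i2])
  also have "(\<integral>(t, x). F I x * g x t * ln (F I x * g x t) \<partial>(?N \<Otimes>\<^sub>M G I)) = (\<integral>y. F ?J y * ln (F ?J y) \<partial>G ?J)"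
    unfolding Fg by (rule iu'[OF i1])
  finally show ?case
    using law S'b by (intro bexI[where x = S']) auto
qed

end

section \<open>The standard Gaussian measure on Euclidean space\<close>

lemma density_PiM_lborel:
  assumes "finite I"
  shows "density (\<Pi>\<^sub>M i\<in>I. lborel) (\<lambda>y. \<Prod>i\<in>I. ennreal (std_normal_density (y i)))
    = (\<Pi>\<^sub>M i\<in>I. std_normal_distribution)"
proof -
  interpret N: product_sigma_finite "\<lambda>_. std_normal_distribution"
    by (intro product_sigma_finite.intro normal.sigma_finite_measure_axioms)
  interpret B: product_sigma_finite "\<lambda>_. lborel :: real measure"
    by (intro product_sigma_finite.intro sigma_finite_lborel)
  show ?thesis
  proof (rule N.PiM_eqI[OF assms])
    show "sets (density (\<Pi>\<^sub>M i\<in>I. lborel) (\<lambda>y. \<Prod>i\<in>I. ennreal (std_normal_density (y i))))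
      = sets (\<Pi>\<^sub>M i\<in>I. std_normal_distribution)"
      by (auto intro!: sets_PiM_cong)
    fix A :: "_ \<Rightarrow> real set" assume A: "\<And>i. i \<in> I \<Longrightarrow> A i \<in> sets std_normal_distribution"
    then have [measurable]: "\<And>i. i \<in> I \<Longrightarrow> A i \<in> sets borel" by simp
    have ind: "(\<Prod>i\<in>I. ennreal (std_normal_density (y i))) * indicator (Pi\<^sub>E I A) y
        = (\<Prod>i\<in>I. ennreal (std_normal_density (y i)) * indicator (A i) (y i))"
      if "y \<in> space (\<Pi>\<^sub>M i\<in>I. lborel)" for y :: "_ \<Rightarrow> real"
    proof -
      have "indicator (Pi\<^sub>E I A) y = (\<Prod>i\<in>I. indicator (A i) (y i) :: ennreal)"
        using that assms by (auto simp: space_PiM PiE_iff indicator_def)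
      then show ?thesis by (simp add: prod.distrib)
    qed
    have "emeasure (density (\<Pi>\<^sub>M i\<in>I. lborel) (\<lambda>y. \<Prod>i\<in>I. ennreal (std_normal_density (y i)))) (Pi\<^sub>E I A)
      = (\<integral>\<^sup>+y. (\<Prod>i\<in>I. ennreal (std_normal_density (y i))) * indicator (Pi\<^sub>E I A) y \<partial>(\<Pi>\<^sub>M i\<in>I. lborel))"
      using assms by (intro emeasure_density) (auto intro!: sets_PiM_I_finite)
    also have "\<dots> = (\<integral>\<^sup>+y. (\<Prod>i\<in>I. ennreal (std_normal_density (y i)) * indicator (A i) (y i)) \<partial>(\<Pi>\<^sub>M i\<in>I. lborel))"
      by (rule nn_integral_cong) (rule ind)
    also have "\<dots> = (\<Prod>i\<in>I. \<integral>\<^sup>+t. ennreal (std_normal_density t) * indicator (A i) t \<partial>lborel)"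
      using assms by (intro B.product_nn_integral_prod) auto
    also have "\<dots> = (\<Prod>i\<in>I. emeasure std_normal_distribution (A i))"
      by (intro prod.cong refl) (simp add: emeasure_density)
    finally show "emeasure (density (\<Pi>\<^sub>M i\<in>I. lborel) (\<lambda>y. \<Prod>i\<in>I. ennreal (std_normal_density (y i)))) (Pi\<^sub>E I A)
      = (\<Prod>i\<in>I. emeasure std_normal_distribution (A i))" .
  qed
qed

abbreviation of_coords :: "('a::euclidean_space \<Rightarrow> real) \<Rightarrow> 'a" where
  "of_coords y \<equiv> \<Sum>b\<in>Basis. y b *\<^sub>R b"

lemma inner_of_coords_Basis: "b \<in> Basis \<Longrightarrow> of_coords y \<bullet> b = y b"
  by (rule inner_sum_left_Basis)

lemma norm_eq_sum_Basis: "(norm x)\<^sup>2 = (\<Sum>b\<in>Basis. (x \<bullet> b)\<^sup>2)" for x :: "'a::euclidean_space"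
  by (subst power2_norm_eq_inner, subst euclidean_inner) (simp add: power2_eq_square)

lemma gaussian_density_of_coords:
  "(2 * pi) powr (- real DIM('a) / 2) * exp (- (norm (of_coords y :: 'a::euclidean_space))\<^sup>2 / 2)
    = (\<Prod>b\<in>(Basis::'a set). std_normal_density (y b))"
proof -
  have c: "(2 * pi) powr (- real DIM('a) / 2) = (1 / sqrt (2 * pi)) ^ DIM('a)"
  proof -
    have "(1 / sqrt (2 * pi)) ^ DIM('a) = ((2 * pi) powr (- (1 / 2))) powr real DIM('a)"
      by (simp add: powr_realpow powr_minus powr_half_sqrt inverse_eq_divide)
    then show ?thesis by (simp add: powr_powr)
  qed
  have e: "(norm (of_coords y :: 'a))\<^sup>2 = (\<Sum>b\<in>(Basis::'a set). (y b)\<^sup>2)"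
    unfolding norm_eq_sum_Basis by (intro sum.cong refl) (simp add: inner_of_coords_Basis)
  show ?thesis
    unfolding c e std_normal_density_def prod.distrib
    by (simp add: exp_sum[symmetric] sum_negf sum_divide_distrib)
qed

text \<open>\<open>lborel\<close> is itself the image of the product Lebesgue measure under
  \<open>of_coords\<close>, and the Gaussian density factors over the coordinates.\<close>

lemma std_gaussian_eq_distr:
  "(std_gaussian :: (real ^ 'n) measure) = distr (\<Pi>\<^sub>M b\<in>Basis. std_normal_distribution) borel of_coords"
proof -
  let ?g = "\<lambda>x :: real ^ 'n. ennreal ((2 * pi) powr (- real CARD('n) / 2) * exp (- (norm x)\<^sup>2 / 2))"
  have "(std_gaussian :: (real ^ 'n) measure)
      = density (distr (\<Pi>\<^sub>M b\<in>Basis. lborel) borel of_coords) ?g"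
    unfolding std_gaussian_def by (subst lborel_eq) simp
  also have "\<dots> = distr (density (\<Pi>\<^sub>M b\<in>Basis. lborel) (\<lambda>y. ?g (of_coords y))) borel of_coords"
    by (rule density_distr) auto
  also have "(\<lambda>y. ?g (of_coords y)) = (\<lambda>y. \<Prod>b\<in>(Basis::(real ^ 'n) set). ennreal (std_normal_density (y b)))"
    using gaussian_density_of_coords[where 'a = "real ^ 'n"] by (simp add: prod_ennreal)
  finally show ?thesis by (simp add: density_PiM_lborel)
qed

lemma prob_space_std_gaussian: "prob_space (std_gaussian :: (real ^ 'n) measure)"
  unfolding std_gaussian_eq_distr
  by (intro prob_space.prob_space_distr prob_space_PiM normal.prob_space_axioms) measurable

lemma sets_std_gaussian [simp, measurable_cong]: "sets std_gaussian = sets borel"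
  by (simp add: std_gaussian_def)

lemma space_std_gaussian [simp]: "space std_gaussian = UNIV"
  by (simp add: std_gaussian_def)

text \<open>The Cameron-Martin formula in several dimensions, by translation invariance of
  \<open>lborel\<close> and expansion of the squared norm.\<close>

lemma nn_integral_std_gaussian_shift:
  fixes a :: "real ^ 'n"
  assumes [measurable]: "k \<in> borel_measurable borel"
  shows "(\<integral>\<^sup>+z. k (a + z) \<partial>std_gaussian) = (\<integral>\<^sup>+x. k x * ennreal (exp (x \<bullet> a - (norm a)\<^sup>2 / 2)) \<partial>std_gaussian)"
proof -
  let ?g = "\<lambda>x :: real ^ 'n. ((2 * pi) powr (- real CARD('n) / 2) * exp (- (norm x)\<^sup>2 / 2))"
  have s: "?g (x - a) = ?g x * exp (x \<bullet> a - (norm a)\<^sup>2 / 2)" for x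
    by (simp add: power2_norm_eq_inner inner_diff_left inner_diff_right inner_commute exp_add[symmetric] field_simps)
  have "(\<integral>\<^sup>+z. k (a + z) \<partial>std_gaussian) = (\<integral>\<^sup>+z. ennreal (?g z) * k (a + z) \<partial>lborel)"
    unfolding std_gaussian_def by (subst nn_integral_density) auto
  also have "\<dots> = (\<integral>\<^sup>+x. ennreal (?g (x - a)) * k x \<partial>distr lborel borel ((+) a))"
    by (subst nn_integral_distr) auto
  also have "\<dots> = (\<integral>\<^sup>+x. ennreal (?g x) * (k x * ennreal (exp (x \<bullet> a - (norm a)\<^sup>2 / 2))) \<partial>lborel)"
    unfolding lborel_distr_plus s by (simp add: ennreal_mult mult.assoc mult.commute mult.left_commute)
  also have "\<dots> = (\<integral>\<^sup>+x. k x * ennreal (exp (x \<bullet> a - (norm a)\<^sup>2 / 2)) \<partial>std_gaussian)"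
    unfolding std_gaussian_def by (subst nn_integral_density) auto
  finally show ?thesis .
qed

section \<open>Bounds for exponentials, second moments and Wasserstein distances\<close>

text \<open>The quotient (e^t - 1 - t) / t^2 is a power series with positive coefficients, so on
  [-4, 4] it is largest at t = 4, where its value is \<open>c4\<close>.\<close>

lemma exp_le_quadratic:
  fixes t :: real
  assumes "\<bar>t\<bar> \<le> 4"
  shows "exp t \<le> 1 + t + c4 * t\<^sup>2"
proof -
  have e: "exp x = 1 + x + (\<Sum>n. inverse (fact (n + 2)) * x ^ n) * x\<^sup>2"
    and sm: "summable (\<lambda>n. inverse (fact (n + 2)) * x ^ n)" for x :: real
  proof -
    have s2: "summable (\<lambda>n. inverse (fact (n + 2)) * x ^ (n + 2))"
      using summable_exp[of x] summable_iff_shift[of "\<lambda>n. inverse (fact n) * x ^ n" 2] by blast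
    show sm: "summable (\<lambda>n. inverse (fact (n + 2)) * x ^ n)"
    proof (rule summable_comparison_test')
      show "summable (\<lambda>n. inverse (fact n) * \<bar>x\<bar> ^ n)" by (rule summable_exp)
      show "norm (inverse (fact (n + 2)) * x ^ n) \<le> inverse (fact n) * \<bar>x\<bar> ^ n" for n
        by (simp add: abs_mult power_abs del: fact_Suc) (intro mult_right_mono le_imp_inverse_le, auto simp del: fact_Suc intro!: fact_mono)
    qed
    have "exp x = 1 + x + (\<Sum>n. inverse (fact (n + 2)) * x ^ n * x\<^sup>2)"
      using exp_first_two_terms[of x] by (simp add: power2_eq_square mult_ac del: fact_Suc)
    then show "exp x = 1 + x + (\<Sum>n. inverse (fact (n + 2)) * x ^ n) * x\<^sup>2"
      using suminf_mult2[OF sm] by simp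
  qed
  have "(\<Sum>n. inverse (fact (n + 2)) * t ^ n) \<le> (\<Sum>n. inverse (fact (n + 2)) * 4 ^ n)"
  proof (rule suminf_le[OF _ sm sm])
    show "inverse (fact (n + 2)) * t ^ n \<le> inverse (fact (n + 2)) * 4 ^ n" for n
    proof (rule mult_left_mono)
      have "t ^ n \<le> \<bar>t\<bar> ^ n" by (metis abs_ge_self power_abs)
      also have "\<dots> \<le> 4 ^ n" using assms by (intro power_mono) auto
      finally show "t ^ n \<le> 4 ^ n" .
    qed simp
  qed
  also have "(\<Sum>n. inverse (fact (n + 2)) * 4 ^ n) = c4"
    using e[of 4] by (simp add: c4_def)
  finally have "(\<Sum>n. inverse (fact (n + 2)) * t ^ n) * t\<^sup>2 \<le> c4 * t\<^sup>2"
    by (rule mult_right_mono) simp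
  then show ?thesis using e[of t] by simp
qed

lemma nn_Cauchy_Schwarz:
  assumes [measurable]: "u \<in> borel_measurable M" "v \<in> borel_measurable M"
    and nonneg: "\<And>x. 0 \<le> u x" "\<And>x. 0 \<le> v x" "0 \<le> A" "0 \<le> B"
    and u: "(\<integral>\<^sup>+x. ennreal ((u x)\<^sup>2) \<partial>M) \<le> ennreal (A\<^sup>2)"
    and v: "(\<integral>\<^sup>+x. ennreal ((v x)\<^sup>2) \<partial>M) \<le> ennreal (B\<^sup>2)"
  shows "(\<integral>\<^sup>+x. ennreal (u x * v x) \<partial>M) \<le> ennreal (A * B)"
proof -
  let ?I = "\<integral>\<^sup>+x. ennreal (u x * v x) \<partial>M"
  have "?I\<^sup>2 \<le> (\<integral>\<^sup>+x. ennreal (u x) ^ 2 \<partial>M) * (\<integral>\<^sup>+x. ennreal (v x) ^ 2 \<partial>M)"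
    using nonneg Cauchy_Schwarz_nn_integral[of "\<lambda>x. ennreal (u x)" M "\<lambda>x. ennreal (v x)"]
    by (simp add: ennreal_mult)
  also have "\<dots> \<le> ennreal (A\<^sup>2) * ennreal (B\<^sup>2)"
    using u v nonneg by (intro mult_mono) (auto simp: ennreal_power)
  also have "\<dots> = ennreal ((A * B)\<^sup>2)"
    by (simp add: ennreal_mult[symmetric] power_mult_distrib)
  finally have I: "?I\<^sup>2 \<le> ennreal ((A * B)\<^sup>2)" .
  then show ?thesis
  proof (cases ?I)
    case (real r)
    then have "r\<^sup>2 \<le> (A * B)\<^sup>2" using I by (simp add: ennreal_power)
    then have "r \<le> A * B" using nonneg by (auto intro: power2_le_imp_le)
    then show ?thesis using real by (simp add: ennreal_leI)
  next
    case top
    then show ?thesis using I by (simp add: power2_eq_square ennreal_top_mult top_unique)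
  qed
qed

text \<open>Expand the square and bound the cross term by \<open>nn_Cauchy_Schwarz\<close>.\<close>

lemma nn_Minkowski:
  assumes [measurable]: "u \<in> borel_measurable M" "v \<in> borel_measurable M"
    and nonneg: "\<And>x. 0 \<le> u x" "\<And>x. 0 \<le> v x" "0 \<le> A" "0 \<le> B"
    and u: "(\<integral>\<^sup>+x. ennreal ((u x)\<^sup>2) \<partial>M) \<le> ennreal (A\<^sup>2)"
    and v: "(\<integral>\<^sup>+x. ennreal ((v x)\<^sup>2) \<partial>M) \<le> ennreal (B\<^sup>2)"
  shows "(\<integral>\<^sup>+x. ennreal ((u x + v x)\<^sup>2) \<partial>M) \<le> ennreal ((A + B)\<^sup>2)"
proof -
  have "(\<integral>\<^sup>+x. ennreal ((u x + v x)\<^sup>2) \<partial>M)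
      = (\<integral>\<^sup>+x. ennreal ((u x)\<^sup>2) + (ennreal ((v x)\<^sup>2) + 2 * ennreal (u x * v x)) \<partial>M)"
    using nonneg
    by (intro nn_integral_cong) (simp add: ennreal_plus[symmetric] ennreal_mult[symmetric] ennreal_numeral[symmetric] power2_sum
        del: ennreal_plus ennreal_numeral)
  also have "\<dots> = (\<integral>\<^sup>+x. ennreal ((u x)\<^sup>2) \<partial>M) + ((\<integral>\<^sup>+x. ennreal ((v x)\<^sup>2) \<partial>M) + 2 * (\<integral>\<^sup>+x. ennreal (u x * v x) \<partial>M))"
    by (simp add: nn_integral_add nn_integral_cmult)
  also have "\<dots> \<le> ennreal (A\<^sup>2) + (ennreal (B\<^sup>2) + 2 * ennreal (A * B))"
    by (intro add_mono u v mult_left_mono nn_Cauchy_Schwarz assms) auto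
  also have "\<dots> = ennreal ((A + B)\<^sup>2)"
    using nonneg
    by (simp add: ennreal_plus[symmetric] ennreal_mult[symmetric] ennreal_numeral[symmetric] power2_sum
        del: ennreal_plus ennreal_numeral)
  finally show ?thesis .
qed

text \<open>One coupling bounds the infimum; the finite bound also rules out the infinite branch of
  the definition.\<close>

lemma wasserstein_le:
  assumes "\<pi> \<in> couplings \<mu> \<nu>" "0 < p" "0 \<le> C"
    and "(\<integral>\<^sup>+z. ennreal (norm (fst z - snd z) powr p) \<partial>\<pi>) \<le> ennreal (C powr p)"
  shows "wasserstein p \<mu> \<nu> \<le> ennreal C"
proof -
  have t: "transport_cost p \<mu> \<nu> \<le> ennreal (C powr p)"
    unfolding transport_cost_def using assms(1,4) by (rule INF_lower2)
  then have "enn2real (transport_cost p \<mu> \<nu>) \<le> C powr p"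
    using enn2real_mono[OF t] by simp
  then have "enn2real (transport_cost p \<mu> \<nu>) powr (1 / p) \<le> (C powr p) powr (1 / p)"
    using assms(2) by (intro powr_mono2) auto
  also have "\<dots> = C" using assms(2,3) by (simp add: powr_powr)
  finally show ?thesis
    using t by (auto simp: wasserstein_def top_unique intro: ennreal_leI)
qed

section \<open>Transporting a smoothed bounded vector to the Gaussian\<close>

lemma c4_nonneg: "0 \<le> c4"
  using exp_ge_add_one_self[of 4] by (simp add: c4_def)

locale bounded_vector = prob_space +
  fixes Y :: "'a \<Rightarrow> real ^ 'n" and R :: real
  assumes measurable_Y [measurable]: "Y \<in> borel_measurable M"
    and bounded_Y: "\<omega> \<in> space M \<Longrightarrow> norm (Y \<omega>) \<le> R"
begin

definition W :: "real ^ 'n \<Rightarrow> 'a \<Rightarrow> real" where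
  "W x \<omega> = exp (x \<bullet> Y \<omega> - (norm (Y \<omega>))\<^sup>2 / 2)"

definition f :: "real ^ 'n \<Rightarrow> real" where
  "f x = (\<integral>\<omega>. W x \<omega> \<partial>M)"

text \<open>Extended by zero off \<open>Basis\<close>, because \<open>bounded_family\<close> demands
  measurability and the bound at every index of the type.\<close>

definition coord :: "real ^ 'n \<Rightarrow> 'a \<Rightarrow> real" where
  "coord b \<omega> = (if b \<in> Basis then Y \<omega> \<bullet> b else 0)"

lemma measurable_Y_nth [measurable]: "(\<lambda>\<omega>. Y \<omega> $ i) \<in> borel_measurable M"
  by (rule borel_measurable_continuous_on[OF _ measurable_Y]) (intro continuous_intros)

lemma R_nonneg: "0 \<le> R"
  using not_empty bounded_Y norm_ge_zero by (meson all_not_in_conv order_trans)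

sublocale fam: bounded_family M coord R
proof
  show "coord b \<in> borel_measurable M" for b
    unfolding coord_def[abs_def] by measurable
  show "\<bar>coord b \<omega>\<bar> \<le> R" if "\<omega> \<in> space M" for b \<omega>
    using Basis_le_norm[of b "Y \<omega>"] bounded_Y[OF that] R_nonneg by (auto simp: coord_def)
qed

lemma measurable_W_pair [measurable]: "(\<lambda>(x, \<omega>). W x \<omega>) \<in> borel_measurable (borel \<Otimes>\<^sub>M M)"
  unfolding W_def by measurable

lemma measurable_f [measurable]: "f \<in> borel_measurable borel"
  unfolding f_def[abs_def] by measurable

lemma W_eq: "W x \<omega> = exp (fam.L Basis (\<lambda>b. x \<bullet> b) \<omega>)"
proof -
  have "fam.L Basis (\<lambda>b. x \<bullet> b) \<omega> = (\<Sum>b\<in>Basis. (x \<bullet> b) * (Y \<omega> \<bullet> b) - (Y \<omega> \<bullet> b)\<^sup>2 / 2)"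
    unfolding fam.L_def by (intro sum.cong refl) (simp add: coord_def)
  also have "\<dots> = x \<bullet> Y \<omega> - (norm (Y \<omega>))\<^sup>2 / 2"
    unfolding norm_eq_sum_Basis by (subst euclidean_inner) (simp add: sum_subtractf sum_divide_distrib)
  finally show ?thesis by (simp add: W_def)
qed

lemma f_eq: "f x = fam.F Basis (\<lambda>b. x \<bullet> b)"
  unfolding f_def fam.F_def W_eq ..

lemma F_eq: "fam.F Basis y = f (of_coords y)"
proof -
  have "fam.L Basis y = fam.L Basis (\<lambda>b. of_coords y \<bullet> b)"
    unfolding fam.L_def[abs_def] by (simp add: inner_of_coords_Basis cong: sum.cong)
  then show ?thesis unfolding f_eq fam.F_def by simp
qed

lemma f_pos: "0 < f x"
  unfolding f_eq by (rule fam.F_pos)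

lemma integrable_W: "integrable M (W x)"
  unfolding W_eq[abs_def] by (rule fam.integrable_L)

lemma ennreal_f: "ennreal (f x) = (\<integral>\<^sup>+\<omega>. ennreal (W x \<omega>) \<partial>M)"
  unfolding f_def by (rule nn_integral_eq_integral[symmetric, OF integrable_W]) (simp add: W_def)

lemma integrable_f_entropy: "integrable std_gaussian (\<lambda>x. f x * ln (f x))"
proof -
  have "integrable (fam.G Basis) (\<lambda>y. f (of_coords y) * ln (f (of_coords y)))"
    using fam.integrable_F_entropy[of Basis] by (simp add: F_eq)
  then show ?thesis
    unfolding std_gaussian_eq_distr by (subst integrable_distr_eq) auto
qed

text \<open>The product statement is conjugated by the coordinate isomorphism: \<open>T\<close>
  assembles a vector from its coordinates and \<open>C\<close> extracts them.\<close>

lemma transport_entropy_gaussian: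
  "\<exists>S \<in> borel_measurable borel.
     distr (density std_gaussian f) borel S = std_gaussian
   \<and> (\<integral>\<^sup>+x. ennreal ((norm (S x - x))\<^sup>2) \<partial>density std_gaussian f) \<le> ennreal (2 * (\<integral>x. f x * ln (f x) \<partial>std_gaussian))"
proof -
  let ?G = "fam.G (Basis :: (real ^ 'n) set)"
  obtain S where S_meas [measurable]: "S \<in> measurable ?G ?G"
    and S: "distr (density ?G (fam.F Basis)) ?G S = ?G"
    and Sb: "\<And>y b. y \<in> space ?G \<Longrightarrow> b \<in> Basis \<Longrightarrow> \<bar>S y b - y b\<bar> \<le> R"
    and Sc: "(\<integral>y. fam.F Basis y * (\<Sum>b\<in>Basis. (S y b - y b)\<^sup>2) \<partial>?G) \<le> 2 * (\<integral>y. fam.F Basis y * ln (fam.F Basis y) \<partial>?G)"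
    using fam.transport_entropy_PiM[of Basis] by auto
  define T where "T = (of_coords :: (real ^ 'n \<Rightarrow> real) \<Rightarrow> real ^ 'n)"
  define C where "C x = (\<lambda>b\<in>Basis. x \<bullet> b)" for x :: "real ^ 'n"
  have [measurable]: "T \<in> borel_measurable ?G" unfolding T_def by measurable
  have [measurable]: "C \<in> measurable borel ?G"
    unfolding C_def by (intro measurable_restrict) auto
  have CT: "C (T y) = y" if "y \<in> space ?G" for y
    using that by (auto simp: C_def T_def inner_of_coords_Basis space_PiM PiE_iff extensional_def fun_eq_iff)
  have F: "fam.F Basis y = f (T y)" for y by (simp add: F_eq T_def)
  have g: "std_gaussian = distr ?G borel T" unfolding T_def by (rule std_gaussian_eq_distr)
  have dg: "density std_gaussian f = distr (density ?G (fam.F Basis)) borel T"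
    unfolding g F by (rule density_distr) auto
  define S' where "S' x = T (S (C x))" for x
  have [measurable]: "S' \<in> borel_measurable borel" unfolding S'_def by measurable
  have "distr (density std_gaussian f) borel S' = distr (density ?G (fam.F Basis)) borel (S' \<circ> T)"
    unfolding dg by (rule distr_distr) auto
  also have "\<dots> = distr (density ?G (fam.F Basis)) borel (T \<circ> S)"
    by (rule distr_cong) (auto simp: S'_def CT)
  also have "\<dots> = distr (distr (density ?G (fam.F Basis)) ?G S) borel T"
    by (rule distr_distr[symmetric]) auto
  also have "\<dots> = std_gaussian" unfolding S by (rule g[symmetric])
  finally have law: "distr (density std_gaussian f) borel S' = std_gaussian" .
  have meas_b: "(\<lambda>y. h y b) \<in> borel_measurable ?G" if "h \<in> measurable ?G ?G" "b \<in> Basis" for h b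
    using measurable_compose[OF that(1) measurable_component_singleton[OF that(2)]] by simp
  have [measurable]: "(\<lambda>y. \<Sum>b\<in>Basis. (S y b - y b)\<^sup>2) \<in> borel_measurable ?G"
    by (intro borel_measurable_sum borel_measurable_power borel_measurable_diff meas_b[OF S_meas]
        meas_b[OF measurable_ident_sets[OF refl]])
  have cost: "(norm (S' (T y) - T y))\<^sup>2 = (\<Sum>b\<in>Basis. (S y b - y b)\<^sup>2)" if "y \<in> space ?G" for y
    unfolding norm_eq_sum_Basis S'_def CT[OF that]
    by (intro sum.cong refl) (simp add: T_def inner_diff_left inner_of_coords_Basis)
  interpret G: prob_space ?G by (intro prob_space_PiM normal.prob_space_axioms)
  have P: "prob_space (density ?G (fam.F Basis))"
  proof (rule prob_space_distrD[of S _ ?G])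
    show "prob_space (distr (density ?G (fam.F Basis)) ?G S)" unfolding S by (rule G.prob_space_axioms)
  qed simp
  have i: "integrable ?G (\<lambda>y. fam.F Basis y * (\<Sum>b\<in>Basis. (S y b - y b)\<^sup>2))"
  proof -
    have "(\<Sum>b\<in>Basis. (S y b - y b)\<^sup>2) \<le> real DIM(real ^ 'n) * R\<^sup>2" if "y \<in> space ?G" for y
      using Sb[OF that] R_nonneg
      by (intro sum_bounded_above) (simp add: abs_le_square_iff[symmetric])
    then have "integrable (density ?G (fam.F Basis)) (\<lambda>y. \<Sum>b\<in>Basis. (S y b - y b)\<^sup>2)"
      using prob_space.finite_measure[OF P]
      by (intro finite_measure.integrable_const_bound[where B = "real DIM(real ^ 'n) * R\<^sup>2"])
        (auto simp: sum_nonneg)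
    then show ?thesis by (subst (asm) integrable_density) (auto simp: fam.F_pos less_imp_le)
  qed
  have "(\<integral>\<^sup>+x. ennreal ((norm (S' x - x))\<^sup>2) \<partial>density std_gaussian f)
      = (\<integral>\<^sup>+y. ennreal ((norm (S' (T y) - T y))\<^sup>2) \<partial>density ?G (fam.F Basis))"
    unfolding dg by (subst nn_integral_distr) auto
  also have "\<dots> = (\<integral>\<^sup>+y. ennreal (fam.F Basis y) * ennreal ((norm (S' (T y) - T y))\<^sup>2) \<partial>?G)"
    by (subst nn_integral_density) auto
  also have "\<dots> = (\<integral>\<^sup>+y. ennreal (fam.F Basis y * (\<Sum>b\<in>Basis. (S y b - y b)\<^sup>2)) \<partial>?G)"
    by (intro nn_integral_cong) (simp add: cost ennreal_mult sum_nonneg fam.F_pos less_imp_le)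
  also have "\<dots> = ennreal (\<integral>y. fam.F Basis y * (\<Sum>b\<in>Basis. (S y b - y b)\<^sup>2) \<partial>?G)"
    by (rule nn_integral_eq_integral[OF i]) (simp add: sum_nonneg fam.F_pos less_imp_le)
  also have "\<dots> \<le> ennreal (2 * (\<integral>y. fam.F Basis y * ln (fam.F Basis y) \<partial>?G))"
    using Sc by (rule ennreal_leI)
  also have "(\<integral>y. fam.F Basis y * ln (fam.F Basis y) \<partial>?G) = (\<integral>x. f x * ln (f x) \<partial>std_gaussian)"
    unfolding g F by (subst integral_distr) auto
  finally show ?thesis
    using law by (intro bexI[where x = S']) auto
qed

text \<open>For each \<open>\<omega>\<close> the shift by \<open>Y \<omega>\<close> becomes the
  weight \<open>W x \<omega>\<close>; exchanging the integrals averages it to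
  \<open>f x\<close>.\<close>

lemma distr_add_gaussian:
  "distr (M \<Otimes>\<^sub>M std_gaussian) borel (\<lambda>(\<omega>, z). Y \<omega> + z) = density std_gaussian f"
proof (rule measure_eqI)
  interpret g: prob_space "std_gaussian :: (real ^ 'n) measure" by (rule prob_space_std_gaussian)
  interpret pair_sigma_finite M "std_gaussian :: (real ^ 'n) measure"
    by (intro pair_sigma_finite.intro sigma_finite_measure_axioms g.sigma_finite_measure_axioms)
  fix A assume "A \<in> sets (distr (M \<Otimes>\<^sub>M std_gaussian) borel (\<lambda>(\<omega>, z). Y \<omega> + z))"
  then have [measurable]: "A \<in> sets borel" by simp
  have "emeasure (distr (M \<Otimes>\<^sub>M std_gaussian) borel (\<lambda>(\<omega>, z). Y \<omega> + z)) A
      = (\<integral>\<^sup>+w. indicator A (case w of (\<omega>, z) \<Rightarrow> Y \<omega> + z) \<partial>(M \<Otimes>\<^sub>M std_gaussian))"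
    by (subst nn_integral_indicator[symmetric], simp, subst nn_integral_distr) auto
  also have "\<dots> = (\<integral>\<^sup>+\<omega>. \<integral>\<^sup>+z. indicator A (Y \<omega> + z) \<partial>std_gaussian \<partial>M)"
    by (subst g.nn_integral_fst[symmetric]) auto
  also have "\<dots> = (\<integral>\<^sup>+\<omega>. \<integral>\<^sup>+x. indicator A x * ennreal (W x \<omega>) \<partial>std_gaussian \<partial>M)"
    unfolding W_def by (subst nn_integral_std_gaussian_shift) auto
  also have "\<dots> = (\<integral>\<^sup>+x. \<integral>\<^sup>+\<omega>. indicator A x * ennreal (W x \<omega>) \<partial>M \<partial>std_gaussian)"
    by (rule Fubini'[symmetric]) measurable
  also have "\<dots> = emeasure (density std_gaussian f) A"
    by (simp add: emeasure_density ennreal_f nn_integral_cmult mult.commute)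
  finally show "emeasure (distr (M \<Otimes>\<^sub>M std_gaussian) borel (\<lambda>(\<omega>, z). Y \<omega> + z)) A = emeasure (density std_gaussian f) A" .
qed simp

lemma inner_bound:
  assumes "\<omega> \<in> space M" "\<omega>' \<in> space M"
  shows "\<bar>Y \<omega> \<bullet> Y \<omega>'\<bar> \<le> R\<^sup>2"
proof -
  have "\<bar>Y \<omega> \<bullet> Y \<omega>'\<bar> \<le> norm (Y \<omega>) * norm (Y \<omega>')" by (rule Cauchy_Schwarz_ineq2)
  also have "\<dots> \<le> R * R" using assms bounded_Y R_nonneg by (intro mult_mono) auto
  finally show ?thesis by (simp add: power2_eq_square)
qed

text \<open>Write the square as a double integral over \<open>\<omega>\<close> and
  \<open>\<omega>'\<close>. The product of two weights is
  \<open>exp (Y \<omega> \<bullet> Y \<omega>')\<close> times the likelihood ratio of the shift by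
  the sum, whose Gaussian mean is 1.\<close>

lemma nn_integral_f_square:
  "(\<integral>\<^sup>+x. ennreal ((f x)\<^sup>2) \<partial>std_gaussian) = (\<integral>\<^sup>+\<omega>. \<integral>\<^sup>+\<omega>'. ennreal (exp (Y \<omega> \<bullet> Y \<omega>')) \<partial>M \<partial>M)"
proof -
  interpret g: prob_space "std_gaussian :: (real ^ 'n) measure" by (rule prob_space_std_gaussian)
  interpret pair_sigma_finite M "std_gaussian :: (real ^ 'n) measure"
    by (intro pair_sigma_finite.intro sigma_finite_measure_axioms g.sigma_finite_measure_axioms)
  have 1: "(\<integral>\<^sup>+x. ennreal (exp (x \<bullet> a - (norm a)\<^sup>2 / 2)) \<partial>std_gaussian) = 1" for a :: "real ^ 'n"
    using nn_integral_std_gaussian_shift[of "\<lambda>_. 1" a] g.emeasure_space_1 by simp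
  have W: "W x \<omega> * W x \<omega>' = exp (Y \<omega> \<bullet> Y \<omega>') * exp (x \<bullet> (Y \<omega> + Y \<omega>') - (norm (Y \<omega> + Y \<omega>'))\<^sup>2 / 2)" for x \<omega> \<omega>'
    unfolding W_def exp_add[symmetric]
    by (simp add: power2_norm_eq_inner inner_add_left inner_add_right inner_commute field_simps)
  have WW: "ennreal (W x \<omega>) * ennreal (W x \<omega>')
      = ennreal (exp (Y \<omega> \<bullet> Y \<omega>')) * ennreal (exp (x \<bullet> (Y \<omega> + Y \<omega>') - (norm (Y \<omega> + Y \<omega>'))\<^sup>2 / 2))" for x \<omega> \<omega>'
  proof -
    have "ennreal (W x \<omega>) * ennreal (W x \<omega>') = ennreal (W x \<omega> * W x \<omega>')"
      by (rule ennreal_mult[symmetric]) (simp_all add: W_def)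
    then show ?thesis unfolding W by (simp only: ennreal_mult exp_ge_zero)
  qed
  have "(\<integral>\<^sup>+x. ennreal ((f x)\<^sup>2) \<partial>std_gaussian) = (\<integral>\<^sup>+x. \<integral>\<^sup>+\<omega>. \<integral>\<^sup>+\<omega>'. ennreal (W x \<omega>) * ennreal (W x \<omega>') \<partial>M \<partial>M \<partial>std_gaussian)"
  proof (rule nn_integral_cong)
    fix x
    have "ennreal ((f x)\<^sup>2) = ennreal (f x) * ennreal (f x)"
      using f_pos[of x] by (simp add: power2_eq_square ennreal_mult)
    also have "\<dots> = (\<integral>\<^sup>+\<omega>. ennreal (W x \<omega>) * (\<integral>\<^sup>+\<omega>'. ennreal (W x \<omega>') \<partial>M) \<partial>M)"
      unfolding ennreal_f by (simp add: nn_integral_multc)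
    finally show "ennreal ((f x)\<^sup>2) = (\<integral>\<^sup>+\<omega>. \<integral>\<^sup>+\<omega>'. ennreal (W x \<omega>) * ennreal (W x \<omega>') \<partial>M \<partial>M)"
      by (simp add: nn_integral_cmult)
  qed
  also have "\<dots> = (\<integral>\<^sup>+\<omega>. \<integral>\<^sup>+x. \<integral>\<^sup>+\<omega>'. ennreal (W x \<omega>) * ennreal (W x \<omega>') \<partial>M \<partial>std_gaussian \<partial>M)"
    by (rule Fubini') measurable
  also have "\<dots> = (\<integral>\<^sup>+\<omega>. \<integral>\<^sup>+\<omega>'. \<integral>\<^sup>+x. ennreal (W x \<omega>) * ennreal (W x \<omega>') \<partial>std_gaussian \<partial>M \<partial>M)"
    by (intro nn_integral_cong Fubini') measurable
  also have "\<dots> = (\<integral>\<^sup>+\<omega>. \<integral>\<^sup>+\<omega>'. ennreal (exp (Y \<omega> \<bullet> Y \<omega>')) \<partial>M \<partial>M)"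
  proof (intro nn_integral_cong)
    fix \<omega> \<omega>'
    have "(\<integral>\<^sup>+x. ennreal (W x \<omega>) * ennreal (W x \<omega>') \<partial>std_gaussian)
      = (\<integral>\<^sup>+x. ennreal (exp (Y \<omega> \<bullet> Y \<omega>')) * ennreal (exp (x \<bullet> (Y \<omega> + Y \<omega>') - (norm (Y \<omega> + Y \<omega>'))\<^sup>2 / 2)) \<partial>std_gaussian)"
      by (intro nn_integral_cong) (simp only: WW)
    then show "(\<integral>\<^sup>+x. ennreal (W x \<omega>) * ennreal (W x \<omega>') \<partial>std_gaussian) = ennreal (exp (Y \<omega> \<bullet> Y \<omega>'))"
      by (simp add: nn_integral_cmult 1)
  qed
  finally show ?thesis .
qed

text \<open>Jensen's inequality for the logarithm under the probability density \<open>f\<close>,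
  through the tangent bound ln(f/c) <= f/c - 1: after multiplication by \<open>f\<close> and
  integration, the right side is at most 1 - 1 + ln c.\<close>

lemma entropy_le:
  assumes c: "(\<integral>\<^sup>+x. ennreal ((f x)\<^sup>2) \<partial>std_gaussian) \<le> ennreal c" "0 < c"
  shows "(\<integral>x. f x * ln (f x) \<partial>std_gaussian) \<le> ln c"
proof -
  interpret g: prob_space "std_gaussian :: (real ^ 'n) measure" by (rule prob_space_std_gaussian)
  have i2: "integrable std_gaussian (\<lambda>x. (f x)\<^sup>2)"
    using c(1) by (intro integrableI_bounded) (auto intro: le_less_trans)
  have "(\<integral>x. (f x)\<^sup>2 \<partial>std_gaussian) \<le> c"
    using c by (simp add: nn_integral_eq_integral[OF i2] ennreal_le_iff)
  then have i2c: "(\<integral>x. (f x)\<^sup>2 \<partial>std_gaussian) / c \<le> 1" using c(2) by simp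
  have "emeasure (distr (M \<Otimes>\<^sub>M (std_gaussian :: (real ^ 'n) measure)) borel (\<lambda>(\<omega>, z). Y \<omega> + z)) UNIV = 1"
  proof -
    interpret pair_prob_space M "std_gaussian :: (real ^ 'n) measure" by unfold_locales
    have "prob_space (distr (M \<Otimes>\<^sub>M (std_gaussian :: (real ^ 'n) measure)) borel (\<lambda>(\<omega>, z). Y \<omega> + z))"
      by (rule prob_space_distr) measurable
    then show ?thesis using prob_space.emeasure_space_1 by fastforce
  qed
  then have n1: "(\<integral>\<^sup>+x. ennreal (f x) \<partial>std_gaussian) = 1"
    unfolding distr_add_gaussian by (simp add: emeasure_density)
  have i1: "integrable std_gaussian f"
    using n1 f_pos by (intro integrableI_bounded) (auto simp: less_imp_le abs_of_pos)
  have e1: "integral\<^sup>L std_gaussian f = 1"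
    using n1 f_pos by (subst integral_eq_nn_integral) (auto simp: less_imp_le)
  have "(\<integral>x. f x * ln (f x) \<partial>std_gaussian) \<le> (\<integral>x. (f x)\<^sup>2 / c + (ln c - 1) * f x \<partial>std_gaussian)"
  proof (rule integral_mono)
    fix x
    have "ln (f x / c) \<le> f x / c - 1" using f_pos c(2) by (intro ln_le_minus_one) auto
    then have "f x * ln (f x) \<le> f x * (f x / c - 1 + ln c)"
      using f_pos[of x] c(2) by (intro mult_left_mono) (auto simp: ln_div)
    then show "f x * ln (f x) \<le> (f x)\<^sup>2 / c + (ln c - 1) * f x"
      by (simp add: power2_eq_square algebra_simps)
  qed (use i1 i2 integrable_f_entropy in auto)
  also have "\<dots> = (\<integral>x. (f x)\<^sup>2 \<partial>std_gaussian) / c + (ln c - 1)"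
    using i1 i2 e1 by simp
  finally show ?thesis using i2c by simp
qed

lemma covariance_matrix_centered:
  assumes "integral\<^sup>L M Y = 0"
  shows "covariance_matrix M Y $ i $ j = (\<integral>\<omega>. Y \<omega> $ i * Y \<omega> $ j \<partial>M)"
proof -
  have "integrable M Y"
    by (rule integrable_const_bound[where B = R]) (auto intro: bounded_Y)
  then have "(\<integral>\<omega>. Y \<omega> $ k \<partial>M) = 0" for k
    using integral_bounded_linear[OF bounded_linear_vec_nth, of M Y k] assms by simp
  then show ?thesis by (simp add: covariance_matrix_def)
qed

text \<open>The bound \<open>R \<le> 2\<close> puts the inner product in [-4, 4]. In the quadratic
  bound the linear term vanishes by centring, and the mean of the squared inner product of two
  independent copies is the sum of squared covariance entries.\<close>

lemma nn_integral_exp_inner_le: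
  assumes m: "integral\<^sup>L M Y = 0" and R: "R \<le> 2"
  shows "(\<integral>\<^sup>+\<omega>. \<integral>\<^sup>+\<omega>'. ennreal (exp (Y \<omega> \<bullet> Y \<omega>')) \<partial>M \<partial>M)
    \<le> ennreal (1 + c4 * (frobenius_norm (covariance_matrix M Y))\<^sup>2)"
proof -
  define C where "C i j = (\<integral>\<omega>. Y \<omega> $ i * Y \<omega> $ j \<partial>M)" for i j
  have comp: "\<bar>Y \<omega> $ i\<bar> \<le> R" if "\<omega> \<in> space M" for \<omega> i
    using component_le_norm_cart[of "Y \<omega>" i] bounded_Y[OF that] by linarith
  have i0: "integrable M Y"
    by (rule integrable_const_bound[where B = R]) (auto intro: bounded_Y)
  have i1: "integrable M (\<lambda>\<omega>. Y \<omega> $ i * Y \<omega> $ j)" for i j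
    by (rule integrable_const_bound[where B = "R * R"])
      (auto simp: abs_mult intro!: mult_mono comp R_nonneg)
  have sq: "(Y \<omega> \<bullet> Y \<omega>')\<^sup>2 = (\<Sum>i\<in>UNIV. \<Sum>j\<in>UNIV. (Y \<omega> $ i * Y \<omega> $ j) * (Y \<omega>' $ i * Y \<omega>' $ j))" for \<omega> \<omega>'
    unfolding inner_vec_def power2_eq_square sum_product by (intro sum.cong refl) simp
  have exp4: "exp (Y \<omega> \<bullet> Y \<omega>') \<le> 1 + Y \<omega> \<bullet> Y \<omega>' + c4 * (Y \<omega> \<bullet> Y \<omega>')\<^sup>2"
    if "\<omega> \<in> space M" "\<omega>' \<in> space M" for \<omega> \<omega>'
  proof (rule exp_le_quadratic)
    have "R\<^sup>2 \<le> 2\<^sup>2" using R R_nonneg by (rule power_mono)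
    then show "\<bar>Y \<omega> \<bullet> Y \<omega>'\<bar> \<le> 4" using inner_bound[OF that] by simp
  qed
  have inner_le: "(\<integral>\<^sup>+\<omega>'. ennreal (exp (Y \<omega> \<bullet> Y \<omega>')) \<partial>M)
      \<le> ennreal (1 + c4 * (\<Sum>i\<in>UNIV. \<Sum>j\<in>UNIV. Y \<omega> $ i * Y \<omega> $ j * C i j))"
    if w: "\<omega> \<in> space M" for \<omega>
  proof -
    have "(\<integral>\<^sup>+\<omega>'. ennreal (exp (Y \<omega> \<bullet> Y \<omega>')) \<partial>M) = ennreal (\<integral>\<omega>'. exp (Y \<omega> \<bullet> Y \<omega>') \<partial>M)"
      by (intro nn_integral_eq_integral integrable_const_bound[where B = "exp (R\<^sup>2)"])
        (use inner_bound[OF w] in \<open>auto simp: abs_le_iff\<close>)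
    also have "(\<integral>\<omega>'. exp (Y \<omega> \<bullet> Y \<omega>') \<partial>M) \<le> (\<integral>\<omega>'. 1 + Y \<omega> \<bullet> Y \<omega>' + c4 * (Y \<omega> \<bullet> Y \<omega>')\<^sup>2 \<partial>M)"
    proof (rule integral_mono)
      show "integrable M (\<lambda>\<omega>'. exp (Y \<omega> \<bullet> Y \<omega>'))"
        by (rule integrable_const_bound[where B = "exp (R\<^sup>2)"])
          (use inner_bound[OF w] in \<open>auto simp: abs_le_iff\<close>)
      show "integrable M (\<lambda>\<omega>'. 1 + Y \<omega> \<bullet> Y \<omega>' + c4 * (Y \<omega> \<bullet> Y \<omega>')\<^sup>2)"
        unfolding sq using i0 i1
        by (intro Bochner_Integration.integrable_add integrable_mult_right Bochner_Integration.integrable_sum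
            integrable_inner_right) auto
    qed (rule exp4[OF w])
    also have "\<dots> = 1 + Y \<omega> \<bullet> integral\<^sup>L M Y + c4 * (\<Sum>i\<in>UNIV. \<Sum>j\<in>UNIV. Y \<omega> $ i * Y \<omega> $ j * C i j)"
      unfolding sq C_def using i0 i1 by (simp add: prob_space Bochner_Integration.integral_sum)
    finally show ?thesis by (simp add: m ennreal_leI)
  qed
  \<comment> \<open>Needed to turn the outer integral into a Bochner integral. Positivity comes for
    free, since the expression dominates an integral of exponentials bounded away from 0.\<close>
  have pos: "0 \<le> 1 + c4 * (\<Sum>i\<in>UNIV. \<Sum>j\<in>UNIV. Y \<omega> $ i * Y \<omega> $ j * C i j)" if "\<omega> \<in> space M" for \<omega>
  proof -
    have "0 < (\<integral>\<^sup>+\<omega>'. ennreal (exp (Y \<omega> \<bullet> Y \<omega>')) \<partial>M)"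
    proof -
      have "ennreal (exp (- (R\<^sup>2))) = (\<integral>\<^sup>+\<omega>'. ennreal (exp (- (R\<^sup>2))) \<partial>M)"
        by (simp add: emeasure_space_1)
      also have "\<dots> \<le> (\<integral>\<^sup>+\<omega>'. ennreal (exp (Y \<omega> \<bullet> Y \<omega>')) \<partial>M)"
        using inner_bound[OF that] by (intro nn_integral_mono ennreal_leI) (force simp: abs_le_iff)
      finally show ?thesis by (rule less_le_trans[rotated]) simp
    qed
    then have "0 < ennreal (1 + c4 * (\<Sum>i\<in>UNIV. \<Sum>j\<in>UNIV. Y \<omega> $ i * Y \<omega> $ j * C i j))"
      using inner_le[OF that] by (rule less_le_trans)
    then show ?thesis by simp
  qed
  have "(\<integral>\<^sup>+\<omega>. \<integral>\<^sup>+\<omega>'. ennreal (exp (Y \<omega> \<bullet> Y \<omega>')) \<partial>M \<partial>M)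
      \<le> (\<integral>\<^sup>+\<omega>. ennreal (1 + c4 * (\<Sum>i\<in>UNIV. \<Sum>j\<in>UNIV. Y \<omega> $ i * Y \<omega> $ j * C i j)) \<partial>M)"
    by (intro nn_integral_mono inner_le)
  also have "\<dots> = ennreal (\<integral>\<omega>. 1 + c4 * (\<Sum>i\<in>UNIV. \<Sum>j\<in>UNIV. Y \<omega> $ i * Y \<omega> $ j * C i j) \<partial>M)"
    using i1 pos by (intro nn_integral_eq_integral Bochner_Integration.integrable_add integrable_mult_right
      Bochner_Integration.integrable_sum integrable_mult_left) auto
  also have "(\<integral>\<omega>. 1 + c4 * (\<Sum>i\<in>UNIV. \<Sum>j\<in>UNIV. Y \<omega> $ i * Y \<omega> $ j * C i j) \<partial>M)
      = 1 + c4 * (\<Sum>i\<in>UNIV. \<Sum>j\<in>UNIV. C i j * C i j)"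
    using i1 by (simp add: prob_space Bochner_Integration.integral_sum C_def)
  also have "(\<Sum>i\<in>UNIV. \<Sum>j\<in>UNIV. C i j * C i j) = (frobenius_norm (covariance_matrix M Y))\<^sup>2"
    unfolding frobenius_norm_def covariance_matrix_centered[OF m] C_def
    by (simp add: sum_nonneg power2_eq_square)
  finally show ?thesis .
qed

lemma transport_gaussian_smoothed:
  assumes m: "integral\<^sup>L M Y = 0" and R: "R \<le> 2"
  shows "\<exists>S \<in> borel_measurable borel.
     distr (M \<Otimes>\<^sub>M std_gaussian) borel (\<lambda>(\<omega>, z). S (Y \<omega> + z)) = std_gaussian
   \<and> (\<integral>\<^sup>+(\<omega>, z). ennreal ((norm (S (Y \<omega> + z) - (Y \<omega> + z)))\<^sup>2) \<partial>(M \<Otimes>\<^sub>M std_gaussian))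
      \<le> ennreal (2 * ln (1 + c4 * (frobenius_norm (covariance_matrix M Y))\<^sup>2))"
proof -
  let ?P = "M \<Otimes>\<^sub>M (std_gaussian :: (real ^ 'n) measure)"
  let ?c = "1 + c4 * (frobenius_norm (covariance_matrix M Y))\<^sup>2"
  obtain S where [measurable]: "S \<in> borel_measurable borel"
    and S: "distr (density std_gaussian f) borel S = std_gaussian"
    and Sc: "(\<integral>\<^sup>+x. ennreal ((norm (S x - x))\<^sup>2) \<partial>density std_gaussian f) \<le> ennreal (2 * (\<integral>x. f x * ln (f x) \<partial>std_gaussian))"
    using transport_entropy_gaussian by blast
  have "distr ?P borel (\<lambda>(\<omega>, z). S (Y \<omega> + z)) = distr (distr ?P borel (\<lambda>(\<omega>, z). Y \<omega> + z)) borel S"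
    by (subst distr_distr) (auto simp: comp_def split_beta')
  then have 1: "distr ?P borel (\<lambda>(\<omega>, z). S (Y \<omega> + z)) = std_gaussian"
    unfolding distr_add_gaussian S .
  have "0 < ?c" using c4_nonneg by (intro add_pos_nonneg) auto
  then have "(\<integral>x. f x * ln (f x) \<partial>std_gaussian) \<le> ln ?c"
    using nn_integral_exp_inner_le[OF m R] by (intro entropy_le) (simp_all add: nn_integral_f_square)
  then have "ennreal (2 * (\<integral>x. f x * ln (f x) \<partial>std_gaussian)) \<le> ennreal (2 * ln ?c)"
    by (intro ennreal_leI) simp
  moreover have "(\<integral>\<^sup>+(\<omega>, z). ennreal ((norm (S (Y \<omega> + z) - (Y \<omega> + z)))\<^sup>2) \<partial>?P)
      = (\<integral>\<^sup>+x. ennreal ((norm (S x - x))\<^sup>2) \<partial>density std_gaussian f)"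
    unfolding distr_add_gaussian[symmetric] by (subst nn_integral_distr) (auto simp: split_beta')
  ultimately show ?thesis
    using 1 Sc by (intro bexI[where x = S]) auto
qed

end

section \<open>Truncation\<close>

locale square_integrable_vector = prob_space +
  fixes X :: "'a \<Rightarrow> real ^ 'n"
  assumes measurable_X [measurable]: "X \<in> borel_measurable M"
    and square_integrable: "integrable M (\<lambda>\<omega>. (norm (X \<omega>))\<^sup>2)"
    and centered: "integral\<^sup>L M X = 0"
begin

definition tail :: "'a \<Rightarrow> real" where
  "tail \<omega> = norm (X \<omega>) * indicator {\<omega>. norm (X \<omega>) > 1} \<omega>"

abbreviation "m \<equiv> integral\<^sup>L M (truncate1 X)"
abbreviation "Y \<equiv> centered_truncation M X"

lemma tail_nonneg: "0 \<le> tail \<omega>"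
  by (simp add: tail_def)

lemma measurable_tail [measurable]: "tail \<in> borel_measurable M"
proof -
  have "tail = (\<lambda>\<omega>. if 1 < norm (X \<omega>) then norm (X \<omega>) else 0)"
    by (auto simp: tail_def fun_eq_iff)
  then show ?thesis by simp
qed

lemma measurable_truncate1 [measurable]: "truncate1 X \<in> borel_measurable M"
proof -
  have "truncate1 X = (\<lambda>\<omega>. if norm (X \<omega>) \<le> 1 then X \<omega> else 0)"
    by (auto simp: truncate1_def fun_eq_iff)
  then show ?thesis by simp
qed

lemma norm_truncate1_le: "norm (truncate1 X \<omega>) \<le> 1"
  by (auto simp: truncate1_def indicator_def)

lemma norm_diff_truncate1: "norm (X \<omega> - truncate1 X \<omega>) = tail \<omega>"
  by (auto simp: truncate1_def tail_def indicator_def)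

lemma integrable_X: "integrable M X"
proof (rule Bochner_Integration.integrable_bound)
  show "integrable M (\<lambda>\<omega>. 1 + (norm (X \<omega>))\<^sup>2)"
    using square_integrable by simp
  show "AE \<omega> in M. norm (X \<omega>) \<le> norm (1 + (norm (X \<omega>))\<^sup>2)"
  proof (rule AE_I2)
    fix \<omega>
    have "0 \<le> (norm (X \<omega>) - 1)\<^sup>2" by simp
    then have "2 * norm (X \<omega>) \<le> 1 + (norm (X \<omega>))\<^sup>2" by (simp add: power2_diff)
    then have "norm (X \<omega>) \<le> 1 + (norm (X \<omega>))\<^sup>2" using norm_ge_zero[of "X \<omega>"] by linarith
    then show "norm (X \<omega>) \<le> norm (1 + (norm (X \<omega>))\<^sup>2)" by simp
  qed
qed simp

lemma integrable_truncate1: "integrable M (truncate1 X)"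
  by (rule integrable_const_bound[where B = 1]) (auto intro: norm_truncate1_le)

lemma integrable_tail: "integrable M tail"
  by (rule Bochner_Integration.integrable_bound[OF integrable_norm[OF integrable_X]])
    (auto simp: tail_def indicator_def)

lemma integrable_tail_square: "integrable M (\<lambda>\<omega>. (tail \<omega>)\<^sup>2)"
  by (rule Bochner_Integration.integrable_bound[OF square_integrable])
    (auto simp: tail_def indicator_def)

lemma tail_moment1_eq: "tail_moment1 M X = integral\<^sup>L M tail"
  by (simp add: tail_moment1_def tail_def[abs_def])

lemma tail_moment2_eq: "(tail_moment2 M X)\<^sup>2 = (\<integral>\<omega>. (tail \<omega>)\<^sup>2 \<partial>M)"
proof -
  have "(\<lambda>\<omega>. (tail \<omega>)\<^sup>2) = (\<lambda>\<omega>. (norm (X \<omega>))\<^sup>2 * indicator {\<omega>. norm (X \<omega>) > 1} \<omega>)"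
    by (auto simp: tail_def indicator_def fun_eq_iff)
  moreover have "0 \<le> (\<integral>\<omega>. (tail \<omega>)\<^sup>2 \<partial>M)" by simp
  ultimately show ?thesis by (simp add: tail_moment2_def)
qed

lemma tail_moment1_nonneg: "0 \<le> tail_moment1 M X"
  unfolding tail_moment1_eq by (simp add: tail_nonneg)

lemma tail_moment2_nonneg: "0 \<le> tail_moment2 M X"
  unfolding tail_moment2_def by (auto intro!: Bochner_Integration.integral_nonneg)

lemma nn_integral_tail: "(\<integral>\<^sup>+\<omega>. ennreal (tail \<omega>) \<partial>M) = ennreal (tail_moment1 M X)"
  unfolding tail_moment1_eq by (rule nn_integral_eq_integral[OF integrable_tail]) (simp add: tail_nonneg)

lemma nn_integral_tail_square: "(\<integral>\<^sup>+\<omega>. ennreal ((tail \<omega>)\<^sup>2) \<partial>M) = ennreal ((tail_moment2 M X)\<^sup>2)"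
  unfolding tail_moment2_eq by (rule nn_integral_eq_integral[OF integrable_tail_square]) simp

text \<open>Cauchy-Schwarz against the constant 1; it turns min(1, tau_1) into min(1, tau_2) for the
  second distance.\<close>

lemma tail_moment1_le_2: "tail_moment1 M X \<le> tail_moment2 M X"
proof -
  have "(\<integral>\<^sup>+\<omega>. ennreal (tail \<omega> * 1) \<partial>M) \<le> ennreal (tail_moment2 M X * 1)"
    using nn_integral_tail_square
    by (intro nn_Cauchy_Schwarz) (auto simp: tail_nonneg tail_moment2_nonneg emeasure_space_1)
  then show ?thesis by (simp add: nn_integral_tail tail_moment2_nonneg)
qed

lemma norm_m_le: "norm m \<le> min 1 (tail_moment1 M X)"
proof -
  have "norm m \<le> (\<integral>\<omega>. norm (truncate1 X \<omega>) \<partial>M)" by (rule integral_norm_bound)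
  also have "\<dots> \<le> (\<integral>\<omega>. 1 \<partial>M)"
    using integrable_truncate1 by (intro integral_mono) (auto intro: norm_truncate1_le)
  finally have 1: "norm m \<le> 1" by (simp add: prob_space)
  have "norm m = norm (\<integral>\<omega>. X \<omega> - truncate1 X \<omega> \<partial>M)"
    using integrable_X integrable_truncate1 by (simp add: centered)
  also have "\<dots> \<le> (\<integral>\<omega>. norm (X \<omega> - truncate1 X \<omega>) \<partial>M)" by (rule integral_norm_bound)
  finally show ?thesis using 1 by (simp add: norm_diff_truncate1 tail_moment1_eq)
qed

lemma integral_Y: "integral\<^sup>L M Y = 0"
  unfolding centered_truncation_def[abs_def] using integrable_truncate1 by (simp add: prob_space)

text \<open>The radius 2 is the sum of 1 for the truncated vector and 1 for its mean.\<close>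

sublocale trunc: bounded_vector M Y 2
proof
  show "Y \<in> borel_measurable M"
    unfolding centered_truncation_def[abs_def] by measurable
  show "norm (Y \<omega>) \<le> 2" for \<omega>
    using norm_triangle_ineq4[of "truncate1 X \<omega>" m] norm_truncate1_le[of \<omega>] norm_m_le
    by (simp add: centered_truncation_def)
qed

lemma norm_diff_Y_le: "norm (X \<omega> - Y \<omega>) \<le> tail \<omega> + norm m"
  using norm_triangle_ineq[of "X \<omega> - truncate1 X \<omega>" m]
  by (simp add: norm_diff_truncate1 centered_truncation_def algebra_simps)

text \<open>The coupling is the joint law of \<open>X + Z\<close> and \<open>S (Y + Z)\<close> with
  the same \<open>\<omega>\<close> and \<open>Z\<close>. The displacement splits into
  \<open>X - Y\<close>, at most the tail plus \<open>norm m\<close>, and the displacement of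
  \<open>Y + Z\<close> under \<open>S\<close>, with second moment at most r^2.\<close>

lemma wasserstein_gaussian_smoothed:
  assumes \<mu>: "distr M borel X = \<mu>"
  defines "r \<equiv> sqrt (2 * ln (1 + c4 * (frobenius_norm (covariance_matrix M Y))\<^sup>2))"
  shows "wasserstein 1 (\<mu> \<star> std_gaussian) std_gaussian \<le> ennreal (tail_moment1 M X + norm m + r)"
    and "wasserstein 2 (\<mu> \<star> std_gaussian) std_gaussian \<le> ennreal (tail_moment2 M X + norm m + r)"
proof -
  let ?g = "std_gaussian :: (real ^ 'n) measure"
  let ?P = "M \<Otimes>\<^sub>M ?g"
  interpret g: prob_space ?g by (rule prob_space_std_gaussian)
  interpret pair_prob_space M ?g by unfold_locales
  obtain S :: "real ^ 'n \<Rightarrow> real ^ 'n" where [measurable]: "S \<in> borel_measurable borel"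
    and S: "distr ?P borel (\<lambda>(\<omega>, z). S (Y \<omega> + z)) = ?g"
    and Sc: "(\<integral>\<^sup>+(\<omega>, z). ennreal ((norm (S (Y \<omega> + z) - (Y \<omega> + z)))\<^sup>2) \<partial>?P)
      \<le> ennreal (2 * ln (1 + c4 * (frobenius_norm (covariance_matrix M Y))\<^sup>2))"
    using trunc.transport_gaussian_smoothed[OF integral_Y] by auto
  have r: "0 \<le> r" "r\<^sup>2 = 2 * ln (1 + c4 * (frobenius_norm (covariance_matrix M Y))\<^sup>2)"
    using c4_nonneg by (simp_all add: r_def)
  have sets_\<mu> [measurable_cong]: "sets \<mu> = sets borel"
    unfolding \<mu>[symmetric] by simp
  have sets_conv: "sets (\<mu> \<star> ?g) = sets borel"
    by (simp add: convolution_def)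
  define V where "V = (\<lambda>(\<omega>, z). (X \<omega> + z, S (Y \<omega> + z)))"
  have V [measurable]: "V \<in> measurable ?P (borel \<Otimes>\<^sub>M borel)"
    unfolding V_def by measurable
  have conv: "(\<mu> \<star> ?g) = distr ?P borel (\<lambda>(\<omega>, z). X \<omega> + z)"
  proof -
    have "\<mu> \<Otimes>\<^sub>M ?g = distr M borel X \<Otimes>\<^sub>M distr ?g borel (\<lambda>z. z)"
      unfolding \<mu> by (simp add: distr_id2)
    also have "\<dots> = distr ?P (borel \<Otimes>\<^sub>M borel) (\<lambda>(\<omega>, z). (X \<omega>, z))"
      by (rule pair_measure_distr) (auto simp: distr_id2 g.sigma_finite_measure_axioms)
    finally show ?thesis
      unfolding convolution_def by (simp add: distr_distr comp_def split_beta')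
  qed
  define \<pi> where "\<pi> = distr ?P (borel \<Otimes>\<^sub>M borel) V"
  have \<pi>: "\<pi> \<in> couplings (\<mu> \<star> ?g) ?g"
  proof -
    have "distr \<pi> (\<mu> \<star> ?g) fst = distr \<pi> borel fst"
      by (rule distr_cong) (auto simp: sets_conv)
    also have "\<dots> = (\<mu> \<star> ?g)"
      unfolding \<pi>_def conv by (subst distr_distr) (auto simp: comp_def V_def split_beta')
    finally have 1: "distr \<pi> (\<mu> \<star> ?g) fst = (\<mu> \<star> ?g)" .
    have "distr \<pi> ?g snd = distr \<pi> borel snd"
      by (rule distr_cong) auto
    also have "\<dots> = distr ?P borel (\<lambda>(\<omega>, z). S (Y \<omega> + z))"
      unfolding \<pi>_def by (subst distr_distr) (auto simp: comp_def V_def split_beta')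
    finally have 2: "distr \<pi> ?g snd = ?g" unfolding S .
    have "sets \<pi> = sets ((\<mu> \<star> ?g) \<Otimes>\<^sub>M ?g)"
      unfolding \<pi>_def by (simp add: sets_conv cong: sets_pair_measure_cong)
    with 1 2 show ?thesis by (simp add: couplings_def)
  qed
  define a where "a = (\<lambda>w :: 'a \<times> (real ^ 'n). tail (fst w))"
  define d where "d = (\<lambda>w. norm (S (Y (fst w) + snd w) - (Y (fst w) + snd w)))"
  have [measurable]: "a \<in> borel_measurable ?P" "d \<in> borel_measurable ?P"
    unfolding a_def d_def by measurable
  have nn: "0 \<le> a w" "0 \<le> d w" for w by (simp_all add: a_def d_def tail_nonneg)
  have le: "norm (fst (V w) - snd (V w)) \<le> a w + (norm m + d w)" for w
  proof -
    have "fst (V w) - snd (V w) = (X (fst w) - Y (fst w)) - (S (Y (fst w) + snd w) - (Y (fst w) + snd w))"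
      by (simp add: V_def split_beta')
    then have "norm (fst (V w) - snd (V w)) \<le> norm (X (fst w) - Y (fst w)) + d w"
      unfolding d_def by (metis norm_triangle_ineq4)
    then show ?thesis using norm_diff_Y_le[of "fst w"] by (simp add: a_def)
  qed
  have cost: "(\<integral>\<^sup>+z. ennreal (norm (fst z - snd z) powr p) \<partial>\<pi>) \<le> (\<integral>\<^sup>+w. ennreal ((a w + (norm m + d w)) powr p) \<partial>?P)"
    if "0 < p" for p :: real
  proof -
    have "(\<integral>\<^sup>+z. ennreal (norm (fst z - snd z) powr p) \<partial>\<pi>) = (\<integral>\<^sup>+w. ennreal (norm (fst (V w) - snd (V w)) powr p) \<partial>?P)"
      unfolding \<pi>_def by (subst nn_integral_distr) auto
    also have "\<dots> \<le> (\<integral>\<^sup>+w. ennreal ((a w + (norm m + d w)) powr p) \<partial>?P)"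
      using that le by (intro nn_integral_mono ennreal_leI powr_mono2) auto
    finally show ?thesis .
  qed
  have fst_int: "(\<integral>\<^sup>+w. h (fst w) \<partial>?P) = integral\<^sup>N M h" if [measurable]: "h \<in> borel_measurable M" for h
    by (subst g.nn_integral_fst[symmetric]) (auto simp: g.emeasure_space_1[simplified])
  have one: "emeasure ?P (space ?P) = 1" by (rule emeasure_space_1)
  have d2: "(\<integral>\<^sup>+w. ennreal ((d w)\<^sup>2) \<partial>?P) \<le> ennreal (r\<^sup>2)"
    using Sc unfolding r(2) d_def by (simp add: split_beta')
  \<comment> \<open>The first distance also relies on the quadratic transport bound, lowered to a
    first moment by Cauchy-Schwarz.\<close>
  have d1: "(\<integral>\<^sup>+w. ennreal (d w) \<partial>?P) \<le> ennreal r"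
  proof -
    have "(\<integral>\<^sup>+w. ennreal (d w * 1) \<partial>?P) \<le> ennreal (r * 1)"
      using d2 nn r one by (intro nn_Cauchy_Schwarz) auto
    then show ?thesis by simp
  qed
  have a1: "(\<integral>\<^sup>+w. ennreal (a w) \<partial>?P) = ennreal (tail_moment1 M X)"
    unfolding a_def by (subst fst_int) (auto simp: nn_integral_tail)
  have a2: "(\<integral>\<^sup>+w. ennreal ((a w)\<^sup>2) \<partial>?P) = ennreal ((tail_moment2 M X)\<^sup>2)"
    unfolding a_def by (subst fst_int) (auto simp: nn_integral_tail_square)
  show "wasserstein 1 (\<mu> \<star> ?g) ?g \<le> ennreal (tail_moment1 M X + norm m + r)"
  proof (rule wasserstein_le[OF \<pi>])
    have "(\<integral>\<^sup>+z. ennreal (norm (fst z - snd z) powr 1) \<partial>\<pi>) \<le> (\<integral>\<^sup>+w. ennreal ((a w + (norm m + d w)) powr 1) \<partial>?P)"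
      by (rule cost) simp
    also have "\<dots> = (\<integral>\<^sup>+w. ennreal (a w) + (ennreal (norm m) + ennreal (d w)) \<partial>?P)"
      using nn by (intro nn_integral_cong) simp
    also have "\<dots> = (\<integral>\<^sup>+w. ennreal (a w) \<partial>?P) + (ennreal (norm m) + (\<integral>\<^sup>+w. ennreal (d w) \<partial>?P))"
      using one by (simp add: nn_integral_add)
    also have "\<dots> \<le> ennreal (tail_moment1 M X) + (ennreal (norm m) + ennreal r)"
      unfolding a1 by (intro add_mono d1 order_refl)
    also have "\<dots> = ennreal ((tail_moment1 M X + norm m + r) powr 1)"
      using r tail_moment1_nonneg by (simp add: add.assoc)
    finally show "(\<integral>\<^sup>+z. ennreal (norm (fst z - snd z) powr 1) \<partial>\<pi>) \<le> ennreal ((tail_moment1 M X + norm m + r) powr 1)" .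
  qed (use r tail_moment1_nonneg in auto)
  show "wasserstein 2 (\<mu> \<star> ?g) ?g \<le> ennreal (tail_moment2 M X + norm m + r)"
  proof (rule wasserstein_le[OF \<pi>])
    have "(\<integral>\<^sup>+z. ennreal (norm (fst z - snd z) powr 2) \<partial>\<pi>) \<le> (\<integral>\<^sup>+w. ennreal ((a w + (norm m + d w)) powr 2) \<partial>?P)"
      by (rule cost) simp
    also have "\<dots> = (\<integral>\<^sup>+w. ennreal ((a w + (norm m + d w))\<^sup>2) \<partial>?P)"
      using nn by (intro nn_integral_cong) simp
    \<comment> \<open>Minkowski twice: once to split off the tail, once to split the constant
      \<open>norm m\<close> from \<open>d\<close>.\<close>
    also have "\<dots> \<le> ennreal ((tail_moment2 M X + (norm m + r))\<^sup>2)"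
      using nn r one tail_moment2_nonneg a2 d2
      by (intro nn_Minkowski) auto
    also have "\<dots> = ennreal ((tail_moment2 M X + norm m + r) powr 2)"
      using r tail_moment2_nonneg by (simp add: add.assoc)
    finally show "(\<integral>\<^sup>+z. ennreal (norm (fst z - snd z) powr 2) \<partial>\<pi>) \<le> ennreal ((tail_moment2 M X + norm m + r) powr 2)" .
  qed (use r tail_moment2_nonneg in auto)
qed

end

theorem theorem2p4:
  fixes M :: "'s measure" and X :: "'s \<Rightarrow> real ^ 'n" and \<mu> :: "(real ^ 'n) measure"
  assumes "prob_space M"
    and "X \<in> borel_measurable M"
    and "distr M borel X = \<mu>"
    and "integrable M (\<lambda>\<omega>. (norm (X \<omega>))\<^sup>2)"
    and "(\<integral>\<omega>. X \<omega> \<partial>M) = 0"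
  shows "(let \<tau>1 = tail_moment1 M X;
              \<tau>2 = tail_moment2 M X;
              \<Sigma> = covariance_matrix M (centered_truncation M X);
              R = sqrt (2 * ln (1 + c4 * (frobenius_norm \<Sigma>)\<^sup>2))
          in wasserstein 1 (\<mu> \<star> std_gaussian) std_gaussian \<le> ennreal ((\<tau>1 + min 1 \<tau>1) + R)
           \<and> wasserstein 2 (\<mu> \<star> std_gaussian) std_gaussian \<le> ennreal ((\<tau>2 + min 1 \<tau>2) + R)
           \<and> wasserstein 1 (\<mu> \<star> std_gaussian) std_gaussian \<le> ennreal (2 * \<tau>1 + R)
           \<and> wasserstein 2 (\<mu> \<star> std_gaussian) std_gaussian \<le> ennreal (2 * \<tau>2 + R))"
proof -
  interpret square_integrable_vector M X
    using assms by (intro square_integrable_vector.intro square_integrable_vector_axioms.intro)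
  note W = wasserstein_gaussian_smoothed[OF assms(3)]
  have m: "norm m \<le> 1" "norm m \<le> tail_moment1 M X" "norm m \<le> tail_moment2 M X"
    using norm_m_le tail_moment1_le_2 by simp_all
  show ?thesis
    unfolding Let_def
    by (intro conjI order_trans[OF W(1)] order_trans[OF W(2)] ennreal_leI) (use m in auto)
qed

end
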